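(* Let $p$ be any prime and $G:=G_{(1,0)}^{(p)}$. The map $$\alpha:\mathrm{End}(G)\rightarrow \mathrm{Mat}_{4,4}(\mathbb{F}_p)\;{}_{\phi}{\bowtie}_{\psi}\;S_p^1,\qquad \varphi\mapsto(\mathrm{mat}(\mathrm{cent}(\varphi)),\mathrm{vec}(\mathrm{norm}(\varphi))),$$ is an isomorphism of monoids.
   Context: The group. For a prime $p$, $G=G_{(1,0)}^{(p)}$ is the group generated by $a_1,a_2,b_1,b_2$ subject to the relations stating that it is nilpotent of class (at most) $2$ (all commutators are central) together with $$a_1^p=[a_1,b_1],\quad a_2^p=[a_1,b_1],\quad b_1^p=[a_2,b_1b_2],\quad b_2^p=[a_2,b_2],\quad [a_1,a_2]=[b_1,b_2]=1.$$ It has order $p^8$; its center $\zeta G$ equals $G'$ and is elementary abelian with $\mathbb{F}_p$-basis $[a_1,b_1],[a_1,b_2],[a_2,b_1],[a_2,b_2]$, and $G/\zeta G$ is elementary abelian with basis the images of $a_1,a_2,b_1,b_2$. The element $a_1a_2^{-1}$ has order $p$. $\mathrm{End}(G)$ is the monoid of endomorphisms under composition (with $\varphi_1\circ\varphi_2$ meaning first $\varphi_2$, then $\varphi_1$). Two-sided semidirect products. Let $M_1$ be a monoid written additively (identity $0$) and $M_2$ a monoid written multiplicatively (identity $1$), with a left action $\phi$ and a right action $\psi$ of $M_2$ on $M_1$ by monoid endomorphisms such that $(m_2m_1)m_2'=m_2(m_1m_2')$ for all $m_1\in M_1$, $m_2,m_2'\in M_2$. Then $M_1\,{}_{\phi}{\bowtie}_{\psi}\,M_2$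 is the monoid with underlying set $M_1\times M_2$, identity $(0,1)$, and operation $(m_1,m_2)\odot(m_1',m_2'):=(m_1m_2'+m_2m_1',\,m_2m_2')$. The monoid $S_p^1$ and its actions. $S_p$ is the semigroup with underlying set $(\mathbb{Z}/p\mathbb{Z})^4$ and operation $$(x_1,x_2,x_3,x_4)\odot(y_1,y_2,y_3,y_4):=((x_1-x_2)y_1,(x_1-x_2)y_2,(x_1-x_2)y_3,(x_1-x_2)y_4).$$ It has no identity, and $S_p^1$ is the monoid obtained from $S_p$ by adjoining an identity. $\phi$ is the left action of $S_p^1$ on the additive monoid $\mathrm{Mat}_{4,4}(\mathbb{F}_p)$ in which all non-identity elements act as the zero endomorphism (and the identity acts trivially). $\psi$ is the right action of $S_p^1$ on $\mathrm{Mat}_{4,4}(\mathbb{F}_p)$ in which the identity acts trivially and $(a_{i,j})_{1\leq i,j\leq 4}\cdot(x_1,x_2,x_3,x_4):=(x_j(a_{i,1}-a_{i,2}))_{1\leq i,j\leq 4}$. The maps. If $\varphi,f\in\mathrm{End}(G)$ and $f(G)\subseteq\zeta G$, then $\varphi+f$ denotes the endomorphism $g\mapsto\varphi(g)f(g)$. Call an endomorphism of $G$ normalized if it is the identity or maps each of $a_1,a_2,b_1,b_2$ into $\langle a_1a_2^{-1}\rangle$. Every endomorphism $\varphi$ of $G$ has a unique representation $\varphi=\mathrm{norm}(\varphi)+\mathrm{cent}(\varphi)$ with $\mathrm{norm}(\varphi)$ normalized and $\mathrm{cent}(\varphi)$ an endomorphism mapping into $\zeta G$. For a normalized endomorphism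 $\tilde\varphi$, $\mathrm{vec}(\tilde\varphi)\in S_p^1$ is the identity of $S_p^1$ if $\tilde\varphi=\mathrm{id}$, and otherwise the vector $(x_1,x_2,x_3,x_4)\in S_p$ such that $\tilde\varphi$ maps $a_1,a_2,b_1,b_2$, in this order, to $(a_1a_2^{-1})^{x_1},(a_1a_2^{-1})^{x_2},(a_1a_2^{-1})^{x_3},(a_1a_2^{-1})^{x_4}$. For an endomorphism $f$ mapping into $\zeta G$, $\mathrm{mat}(f)\in\mathrm{Mat}_{4,4}(\mathbb{F}_p)$ is the matrix whose $j$-th column is the coordinate vector of the image of the $j$-th generator (order $a_1,a_2,b_1,b_2$) with respect to the basis $[a_1,b_1],[a_1,b_2],[a_2,b_1],[a_2,b_2]$ of $\zeta G$. *)

theory Defs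
  imports "HOL-Analysis.Cartesian_Space" "HOL-Number_Theory.Residues"
    "HOL-Algebra.Generated_Groups"
begin

section \<open>Groups given by generators and relations\<close>

text \<open>A letter \<open>(x, True)\<close> stands for the generator \<open>x\<close>, and \<open>(x, False)\<close> for its inverse.\<close>

type_synonym 'x gword = "('x \<times> bool) list"

definition word_inv :: "'x gword \<Rightarrow> 'x gword" where
  "word_inv w = rev (map (\<lambda>(x, e). (x, \<not> e)) w)"

definition word_pow :: "'x gword \<Rightarrow> nat \<Rightarrow> 'x gword" where
  "word_pow w n = concat (replicate n w)"

definition word_comm :: "'x gword \<Rightarrow> 'x gword \<Rightarrow> 'x gword" where
  "word_comm u v = word_inv u @ word_inv v @ u @ v"

text \<open>The congruence on words generated by free cancellation and the relations \<open>R\<close>, a pair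
  \<open>(u, v)\<close> standing for \<open>u = v\<close>.\<close>

inductive pres_eq :: "('x gword \<times> 'x gword) set \<Rightarrow> 'x gword \<Rightarrow> 'x gword \<Rightarrow> bool" for R where
  pres_refl: "pres_eq R u u"
| pres_sym: "pres_eq R u v \<Longrightarrow> pres_eq R v u"
| pres_trans: "pres_eq R u v \<Longrightarrow> pres_eq R v w \<Longrightarrow> pres_eq R u w"
| pres_append: "pres_eq R u u' \<Longrightarrow> pres_eq R v v' \<Longrightarrow> pres_eq R (u @ v) (u' @ v')"
| pres_cancel: "pres_eq R [(x, e), (x, \<not> e)] []"
| pres_rel: "(u, v) \<in> R \<Longrightarrow> pres_eq R u v"

definition pres_class :: "('x gword \<times> 'x gword) set \<Rightarrow> 'x gword \<Rightarrow> 'x gword set" where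
  "pres_class R w = {v. pres_eq R w v}"

definition presented_group :: "('x gword \<times> 'x gword) set \<Rightarrow> 'x gword set monoid" where
  "presented_group R =
    \<lparr>carrier = range (pres_class R),
     monoid.mult = (\<lambda>X Y. \<Union>u\<in>X. \<Union>v\<in>Y. pres_class R (u @ v)),
     one = pres_class R []\<rparr>"

lemma pres_class_eq_iff: "pres_class R u = pres_class R v \<longleftrightarrow> pres_eq R u v"
  unfolding pres_class_def by (blast intro: pres_refl pres_sym pres_trans)

lemma pres_class_mult:
  "pres_class R u \<otimes>\<^bsub>presented_group R\<^esub> pres_class R v = pres_class R (u @ v)"
  unfolding presented_group_def pres_class_def
  by (auto intro: pres_refl pres_trans[OF pres_append])

lemma pres_word_inv: "pres_eq R (word_inv w @ w) []"
proof (induction w)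
  case Nil
  show ?case by (simp add: word_inv_def pres_refl)
next
  case (Cons l w)
  obtain x e where l: "l = (x, e)" by (cases l)
  have "pres_eq R [(x, \<not> e), (x, e)] []" using pres_cancel[of R x "\<not> e"] by simp
  from pres_append[OF pres_refl[of R "word_inv w"] pres_append[OF this pres_refl[of R w]]]
  have "pres_eq R (word_inv w @ [(x, \<not> e), (x, e)] @ w) (word_inv w @ w)" by simp
  with Cons.IH show ?case by (auto simp: l word_inv_def intro: pres_trans)
qed

lemma group_presented_group: "group (presented_group R)"
proof (rule groupI)
  fix X Y Z
  assume "X \<in> carrier (presented_group R)" "Y \<in> carrier (presented_group R)"
    "Z \<in> carrier (presented_group R)"
  then obtain u v w where "X = pres_class R u" "Y = pres_class R v" "Z = pres_class R w"
    by (auto simp: presented_group_def)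
  then show "X \<otimes>\<^bsub>presented_group R\<^esub> Y \<otimes>\<^bsub>presented_group R\<^esub> Z
      = X \<otimes>\<^bsub>presented_group R\<^esub> (Y \<otimes>\<^bsub>presented_group R\<^esub> Z)"
    by (simp add: pres_class_mult)
next
  fix X Y
  assume "X \<in> carrier (presented_group R)" "Y \<in> carrier (presented_group R)"
  then obtain u v where "X = pres_class R u" "Y = pres_class R v"
    by (auto simp: presented_group_def)
  then have "X \<otimes>\<^bsub>presented_group R\<^esub> Y = pres_class R (u @ v)" by (simp add: pres_class_mult)
  then show "X \<otimes>\<^bsub>presented_group R\<^esub> Y \<in> carrier (presented_group R)"
    by (simp add: presented_group_def)
next
  show "\<one>\<^bsub>presented_group R\<^esub> \<in> carrier (presented_group R)" by (simp add: presented_group_def)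
next
  fix X
  assume "X \<in> carrier (presented_group R)"
  then obtain u where u: "X = pres_class R u" by (auto simp: presented_group_def)
  have one: "\<one>\<^bsub>presented_group R\<^esub> = pres_class R []" by (simp add: presented_group_def)
  show "\<one>\<^bsub>presented_group R\<^esub> \<otimes>\<^bsub>presented_group R\<^esub> X = X" by (simp add: u one pres_class_mult)
  have "pres_class R (word_inv u) \<otimes>\<^bsub>presented_group R\<^esub> X = \<one>\<^bsub>presented_group R\<^esub>"
    by (simp add: u one pres_class_mult pres_class_eq_iff pres_word_inv)
  moreover have "pres_class R (word_inv u) \<in> carrier (presented_group R)"
    by (simp add: presented_group_def)
  ultimately show "\<exists>Y\<in>carrier (presented_group R).
      Y \<otimes>\<^bsub>presented_group R\<^esub> X = \<one>\<^bsub>presented_group R\<^esub>" by blast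
qed

section \<open>The group \<open>G\<close>\<close>

datatype generator = A1 | A2 | B1 | B2

abbreviation letter :: "generator \<Rightarrow> generator gword" where
  "letter x \<equiv> [(x, True)]"

text \<open>The first set expresses nilpotency of class at most 2: the commutator of any two elements
  commutes with every element.\<close>

definition G_relations :: "nat \<Rightarrow> (generator gword \<times> generator gword) set" where
  "G_relations p =
    {(word_comm (word_comm u v) w, []) | u v w. True} \<union>
    {(word_pow (letter A1) p, word_comm (letter A1) (letter B1)),
     (word_pow (letter A2) p, word_comm (letter A1) (letter B1)),
     (word_pow (letter B1) p, word_comm (letter A2) (letter B1 @ letter B2)),
     (word_pow (letter B2) p, word_comm (letter A2) (letter B2)),
     (word_comm (letter A1) (letter A2), []),
     (word_comm (letter B1) (letter B2), [])}"

type_synonym G_elem = "generator gword set"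

definition G :: "nat \<Rightarrow> G_elem monoid" where
  "G p = presented_group (G_relations p)"

definition gen :: "nat \<Rightarrow> generator \<Rightarrow> G_elem" where
  "gen p x = pres_class (G_relations p) (letter x)"

text \<open>The convention \<open>[x, y] = x\<^sup>-\<^sup>1 y\<^sup>-\<^sup>1 x y\<close>; in a group of class at most 2 it agrees with
  \<open>x y x\<^sup>-\<^sup>1 y\<^sup>-\<^sup>1\<close>.\<close>

definition commutator :: "('a, 'b) monoid_scheme \<Rightarrow> 'a \<Rightarrow> 'a \<Rightarrow> 'a" where
  "commutator H x y = inv\<^bsub>H\<^esub> x \<otimes>\<^bsub>H\<^esub> inv\<^bsub>H\<^esub> y \<otimes>\<^bsub>H\<^esub> x \<otimes>\<^bsub>H\<^esub> y"

definition group_center :: "('a, 'b) monoid_scheme \<Rightarrow> 'a set" where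
  "group_center H = {z \<in> carrier H. \<forall>g\<in>carrier H. z \<otimes>\<^bsub>H\<^esub> g = g \<otimes>\<^bsub>H\<^esub> z}"

section \<open>The endomorphism monoid\<close>

text \<open>Endomorphisms are taken to be extensional functions, so that they are determined by their
  values on the carrier. In \<open>compose A g f\<close> the function \<open>f\<close> is applied first.\<close>

definition End :: "('a, 'b) monoid_scheme \<Rightarrow> ('a \<Rightarrow> 'a) monoid" where
  "End H =
    \<lparr>carrier = hom H H \<inter> extensional (carrier H),
     monoid.mult = (\<lambda>f g. compose (carrier H) f g),
     one = (\<lambda>x\<in>carrier H. x)\<rparr>"

section \<open>Two-sided semidirect products\<close>

text \<open>\<open>M1\<close> is the monoid written additively in the mathematical text;
  \<open>\<phi> m m1\<close> is the left action \<open>m m1\<close> and \<open>\<psi> m1 m\<close> is the right action \<open>m1 m\<close>.\<close>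

locale two_sided_action =
  M1: monoid M1 + M2: monoid M2
  for M1 :: "'a monoid" and M2 :: "'b monoid" +
  fixes \<phi> :: "'b \<Rightarrow> 'a \<Rightarrow> 'a" and \<psi> :: "'a \<Rightarrow> 'b \<Rightarrow> 'a"
  assumes left_hom: "m \<in> carrier M2 \<Longrightarrow> \<phi> m \<in> hom M1 M1"
    and left_zero: "m \<in> carrier M2 \<Longrightarrow> \<phi> m \<one>\<^bsub>M1\<^esub> = \<one>\<^bsub>M1\<^esub>"
    and left_one: "a \<in> carrier M1 \<Longrightarrow> \<phi> \<one>\<^bsub>M2\<^esub> a = a"
    and left_mult: "\<lbrakk>m \<in> carrier M2; m' \<in> carrier M2; a \<in> carrier M1\<rbrakk>
      \<Longrightarrow> \<phi> (m \<otimes>\<^bsub>M2\<^esub> m') a = \<phi> m (\<phi> m' a)"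
    and right_hom: "m \<in> carrier M2 \<Longrightarrow> (\<lambda>a. \<psi> a m) \<in> hom M1 M1"
    and right_zero: "m \<in> carrier M2 \<Longrightarrow> \<psi> \<one>\<^bsub>M1\<^esub> m = \<one>\<^bsub>M1\<^esub>"
    and right_one: "a \<in> carrier M1 \<Longrightarrow> \<psi> a \<one>\<^bsub>M2\<^esub> = a"
    and right_mult: "\<lbrakk>m \<in> carrier M2; m' \<in> carrier M2; a \<in> carrier M1\<rbrakk>
      \<Longrightarrow> \<psi> a (m \<otimes>\<^bsub>M2\<^esub> m') = \<psi> (\<psi> a m) m'"
    and compat: "\<lbrakk>m \<in> carrier M2; m' \<in> carrier M2; a \<in> carrier M1\<rbrakk>
      \<Longrightarrow> \<psi> (\<phi> m a) m' = \<phi> m (\<psi> a m')"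

definition two_sided_semidirect ::
  "'a monoid \<Rightarrow> 'b monoid \<Rightarrow> ('b \<Rightarrow> 'a \<Rightarrow> 'a) \<Rightarrow> ('a \<Rightarrow> 'b \<Rightarrow> 'a) \<Rightarrow> ('a \<times> 'b) monoid" where
  "two_sided_semidirect M1 M2 \<phi> \<psi> =
    \<lparr>carrier = carrier M1 \<times> carrier M2,
     monoid.mult = (\<lambda>(m1, m2) (m1', m2'). (\<psi> m1 m2' \<otimes>\<^bsub>M1\<^esub> \<phi> m2 m1', m2 \<otimes>\<^bsub>M2\<^esub> m2')),
     one = (\<one>\<^bsub>M1\<^esub>, \<one>\<^bsub>M2\<^esub>)\<rparr>"

lemma (in two_sided_action) monoid_two_sided_semidirect:
  "monoid (two_sided_semidirect M1 M2 \<phi> \<psi>)"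
proof -
  note closed = hom_in_carrier[OF left_hom] hom_in_carrier[OF right_hom]
  note distrib = hom_mult[OF left_hom] hom_mult[OF right_hom]
  show ?thesis
    by (rule monoidI)
      (auto simp: two_sided_semidirect_def closed distrib left_zero left_one left_mult
        right_zero right_one right_mult compat M1.m_assoc M2.m_assoc)
qed

text \<open>Adjoining an identity \<open>None\<close> to the semigroup with underlying set \<open>S\<close>.\<close>

definition adjoin_one :: "'a set \<Rightarrow> ('a \<Rightarrow> 'a \<Rightarrow> 'a) \<Rightarrow> 'a option monoid" where
  "adjoin_one S f =
    \<lparr>carrier = insert None (Some ` S),
     monoid.mult = (\<lambda>x y. case x of None \<Rightarrow> y
        | Some a \<Rightarrow> (case y of None \<Rightarrow> x | Some b \<Rightarrow> Some (f a b))),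
     one = None\<rparr>"

section \<open>The monoid \<open>S\<^sub>p\<^sup>1\<close> and its actions on matrices\<close>

abbreviation Fp :: "nat \<Rightarrow> int ring" where
  "Fp p \<equiv> residue_ring (int p)"

text \<open>Coordinates are indexed by the type \<open>4\<close>, whose elements are \<open>1, 2, 3, 4\<close>. The entries lie in
  the carrier \<open>{0..p - 1}\<close> of the residue ring.\<close>

definition vecs :: "nat \<Rightarrow> (int ^ 4) set" where
  "vecs p = {x. \<forall>j. x $ j \<in> carrier (Fp p)}"

definition Mat :: "nat \<Rightarrow> (int ^ 4 ^ 4) monoid" where
  "Mat p =
    \<lparr>carrier = {A. \<forall>i j. A $ i $ j \<in> carrier (Fp p)},
     monoid.mult = (\<lambda>A B. \<chi> i j. A $ i $ j \<oplus>\<^bsub>Fp p\<^esub> B $ i $ j),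
     one = (\<chi> i j. \<zero>\<^bsub>Fp p\<^esub>)\<rparr>"

definition S_op :: "nat \<Rightarrow> int ^ 4 \<Rightarrow> int ^ 4 \<Rightarrow> int ^ 4" where
  "S_op p x y = (\<chi> j. (x $ 1 \<ominus>\<^bsub>Fp p\<^esub> x $ 2) \<otimes>\<^bsub>Fp p\<^esub> y $ j)"

definition S1 :: "nat \<Rightarrow> (int ^ 4) option monoid" where
  "S1 p = adjoin_one (vecs p) (S_op p)"

definition phi :: "nat \<Rightarrow> (int ^ 4) option \<Rightarrow> int ^ 4 ^ 4 \<Rightarrow> int ^ 4 ^ 4" where
  "phi p s A = (case s of None \<Rightarrow> A | Some x \<Rightarrow> (\<chi> i j. \<zero>\<^bsub>Fp p\<^esub>))"

definition psi :: "nat \<Rightarrow> int ^ 4 ^ 4 \<Rightarrow> (int ^ 4) option \<Rightarrow> int ^ 4 ^ 4" where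
  "psi p A s = (case s of None \<Rightarrow> A
     | Some x \<Rightarrow> (\<chi> i j. x $ j \<otimes>\<^bsub>Fp p\<^esub> (A $ i $ 1 \<ominus>\<^bsub>Fp p\<^esub> A $ i $ 2)))"

lemma two_sided_action_Mat_S1:
  assumes "1 < p"
  shows "two_sided_action (Mat p) (S1 p) (phi p) (psi p)"
proof -
  interpret residues "int p" "Fp p" using assms by unfold_locales auto
  have Mat: "monoid (Mat p)"
    by (rule monoidI) (auto simp: Mat_def vec_eq_iff a_assoc)
  have S1: "monoid (S1 p)"
    by (rule monoidI)
      (auto simp: S1_def adjoin_one_def vecs_def S_op_def vec_eq_iff minus_eq r_distr l_distr
        m_assoc l_minus r_minus inj_image_mem_iff)
  show ?thesis
    by (intro two_sided_action.intro two_sided_action_axioms.intro Mat S1)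
      (auto simp: S1_def adjoin_one_def vecs_def S_op_def Mat_def phi_def psi_def vec_eq_iff hom_def
        minus_eq r_distr l_distr l_minus r_minus minus_add r_neg a_ac m_ac)
qed

section \<open>The map \<open>\<alpha>\<close>\<close>

definition central_end :: "nat \<Rightarrow> (G_elem \<Rightarrow> G_elem) \<Rightarrow> bool" where
  "central_end p f \<longleftrightarrow> f \<in> carrier (End (G p)) \<and> f ` carrier (G p) \<subseteq> group_center (G p)"

definition end_plus :: "nat \<Rightarrow> (G_elem \<Rightarrow> G_elem) \<Rightarrow> (G_elem \<Rightarrow> G_elem) \<Rightarrow> G_elem \<Rightarrow> G_elem" where
  "end_plus p \<phi> f = (\<lambda>g\<in>carrier (G p). \<phi> g \<otimes>\<^bsub>G p\<^esub> f g)"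

definition a1_a2_inv :: "nat \<Rightarrow> G_elem" where
  "a1_a2_inv p = gen p A1 \<otimes>\<^bsub>G p\<^esub> inv\<^bsub>G p\<^esub> gen p A2"

definition normalized :: "nat \<Rightarrow> (G_elem \<Rightarrow> G_elem) \<Rightarrow> bool" where
  "normalized p \<phi> \<longleftrightarrow> \<phi> \<in> carrier (End (G p)) \<and>
    (\<phi> = \<one>\<^bsub>End (G p)\<^esub> \<or> (\<forall>x. \<phi> (gen p x) \<in> generate (G p) {a1_a2_inv p}))"

definition norm_part :: "nat \<Rightarrow> (G_elem \<Rightarrow> G_elem) \<Rightarrow> (G_elem \<Rightarrow> G_elem)" where
  "norm_part p \<phi> = (THE \<nu>. normalized p \<nu> \<and> (\<exists>f. central_end p f \<and> \<phi> = end_plus p \<nu> f))"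

definition cent_part :: "nat \<Rightarrow> (G_elem \<Rightarrow> G_elem) \<Rightarrow> (G_elem \<Rightarrow> G_elem)" where
  "cent_part p \<phi> = (THE f. central_end p f \<and> (\<exists>\<nu>. normalized p \<nu> \<and> \<phi> = end_plus p \<nu> f))"

definition vec_of :: "nat \<Rightarrow> (G_elem \<Rightarrow> G_elem) \<Rightarrow> (int ^ 4) option" where
  "vec_of p \<phi> = (if \<phi> = \<one>\<^bsub>End (G p)\<^esub> then None
    else Some (THE x. x \<in> vecs p \<and>
      \<phi> (gen p A1) = a1_a2_inv p [^]\<^bsub>G p\<^esub> (x $ 1) \<and>
      \<phi> (gen p A2) = a1_a2_inv p [^]\<^bsub>G p\<^esub> (x $ 2) \<and>
      \<phi> (gen p B1) = a1_a2_inv p [^]\<^bsub>G p\<^esub> (x $ 3) \<and>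
      \<phi> (gen p B2) = a1_a2_inv p [^]\<^bsub>G p\<^esub> (x $ 4)))"

text \<open>The central element with the given coordinates with respect to the basis
  \<open>[a\<^sub>1, b\<^sub>1], [a\<^sub>1, b\<^sub>2], [a\<^sub>2, b\<^sub>1], [a\<^sub>2, b\<^sub>2]\<close>.\<close>

definition center_elem :: "nat \<Rightarrow> int ^ 4 \<Rightarrow> G_elem" where
  "center_elem p v =
    commutator (G p) (gen p A1) (gen p B1) [^]\<^bsub>G p\<^esub> (v $ 1) \<otimes>\<^bsub>G p\<^esub>
    commutator (G p) (gen p A1) (gen p B2) [^]\<^bsub>G p\<^esub> (v $ 2) \<otimes>\<^bsub>G p\<^esub>
    commutator (G p) (gen p A2) (gen p B1) [^]\<^bsub>G p\<^esub> (v $ 3) \<otimes>\<^bsub>G p\<^esub>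
    commutator (G p) (gen p A2) (gen p B2) [^]\<^bsub>G p\<^esub> (v $ 4)"

definition mat_of :: "nat \<Rightarrow> (G_elem \<Rightarrow> G_elem) \<Rightarrow> int ^ 4 ^ 4" where
  "mat_of p f = (THE A. A \<in> carrier (Mat p) \<and>
    f (gen p A1) = center_elem p (column 1 A) \<and>
    f (gen p A2) = center_elem p (column 2 A) \<and>
    f (gen p B1) = center_elem p (column 3 A) \<and>
    f (gen p B2) = center_elem p (column 4 A))"

definition alpha :: "nat \<Rightarrow> (G_elem \<Rightarrow> G_elem) \<Rightarrow> (int ^ 4 ^ 4) \<times> (int ^ 4) option" where
  "alpha p \<phi> = (mat_of p (cent_part p \<phi>), vec_of p (norm_part p \<phi>))"

end

theory Submission
  imports Defs
begin

text \<open>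
  Collecting letters writes every element as
  \<open>a\<^sub>1\<^bsup>x\<^sub>1\<^esup> a\<^sub>2\<^bsup>x\<^sub>2\<^esup> b\<^sub>1\<^bsup>x\<^sub>3\<^esup> b\<^sub>2\<^bsup>x\<^sub>4\<^esup> z\<close> with \<open>z\<close> central, and two such words multiply as in an integral class-2
  group on \<open>\<int>\<^sup>4 \<times> \<int>\<^sup>4\<close> whose cocycle \<open>bil\<close> is bilinear. Hence \<open>G\<close> is the quotient of that group by
  the normal subgroup of the elements \<open>(p t, p v - powv t)\<close>, for every prime including 2.
  An endomorphism is given modulo the center by four vectors over \<open>\<int>/p\<close>; the relations force them
  to be either the four standard vectors or four multiples of \<open>a\<^sub>1 - a\<^sub>2\<close>, while the central
  parts of the four images are arbitrary. So endomorphisms correspond to pairs of a matrix and an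
  element of \<open>S\<^sub>p\<^sup>1\<close>. An endomorphism of the first kind fixes the center, one of the second kind
  kills it, and both map \<open>a\<^sub>1 a\<^sub>2\<^sup>-\<^sup>1\<close> to a power of itself times a central element, which gives the
  multiplication rule.
\<close>

subsection \<open>The relations modulo \<open>p\<close>\<close>

text \<open>A presentation bounds a group only from above; that no further collapse happens has to
  come from a model. Over the integers the model has a bilinear cocycle and no carries, and the
  power relations enter only through the subgroup that is divided out. Endomorphisms are so few
  because the kernel of the power map \<open>powv\<close> is the line spanned by \<open>kv\<close>,
  the exponent vector of \<open>a1 a2^-1\<close>. For odd \<open>p\<close> the power map is linear
  modulo the center. The images of \<open>a1\<close> and \<open>a2\<close> have equal powers, so
  they differ by a multiple of \<open>kv\<close>; if they involve \<open>b1\<close> or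
  \<open>b2\<close>, they even agree modulo the center, because they commute. The relation for
  \<open>b1\<close> then makes its image that of \<open>a1 b2\<close> up to a multiple of
  \<open>kv\<close>, and since it commutes with the image of \<open>b2\<close>, everything collapses
  to a contradiction. Otherwise the exponent of \<open>b2\<close> in its own image separates the two
  types of endomorphisms. For \<open>p = 2\<close> the power map is quadratic and this argument
  breaks down, but only parities remain to be checked.\<close>

lemma endo_equations_2:
  fixes s1 s2 t1 t2 S1 S2 T1 T2 m1 m2 n1 n2 q1 q2 r1 r2 :: int
  assumes "even (s1 + s2 - s1*t1 - (S1 + S2 - S1*T1))"
  "even (s1*t2 - S1*T2)" "even (t1 - s2*t1 - (T1 - S2*T1))" "even (t1+t2-s2*t2 - (T1+T2-S2*T2))"
  "even (s1 + s2 - s1*t1 - (s1*n1 - m1*t1))"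
  "even (- s1*t2 - (s1*n2-m1*t2))" "even (t1 - s2*t1 - (s2*n1-m2*t1))"
    "even (t1+t2-s2*t2 - (s2*n2-m2*t2))"
  "even (m1 + m2 - m1*n1 - (S1*(n1+r1) - (m1+q1)*T1))"
  "even (- m1*n2 - (S1*(n2+r2)-(m1+q1)*T2))" "even (n1 - m2*n1 - (S2*(n1+r1)-(m2+q2)*T1))"
    "even (n1+n2-m2*n2 - (S2*(n2+r2)-(m2+q2)*T2))"
  "even (q1 + q2 - q1*r1 - (S1*r1 - q1*T1))"
  "even (- q1*r2 - (S1*r2-q1*T2))" "even (r1 - q2*r1 - (S2*r1-q2*T1))"
    "even (r1+r2-q2*r2 - (S2*r2-q2*T2))"
  "even (s1*T1-S1*t1)"   "even (s1*T2-S1*t2)"   "even (s2*T1-S2*t1)"   "even (s2*T2-S2*t2)"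
  "even (m1*r1-q1*n1)"   "even (m1*r2-q1*n2)"   "even (m2*r1-q2*n1)"   "even (m2*r2-q2*n2)"
  shows "(odd s1 \<and> even s2 \<and> even t1 \<and> even t2 \<and> even S1 \<and> odd S2 \<and> even T1 \<and> even T2
    \<and> even m1 \<and> even m2 \<and> odd n1 \<and> even n2 \<and> even q1 \<and> even q2 \<and> even r1 \<and> odd r2) \<or>
   (even (s1+s2) \<and> even (S1+S2) \<and> even (m1+m2) \<and> even (q1+q2) \<and> even t1 \<and> even t2 \<and> even T1 \<and> even T2
     \<and> even n1 \<and> even n2 \<and> even r1 \<and> even r2)"
  \<comment> \<open>The unknowns matter only modulo 2, where \<open>p choose 2\<close> is 1. The
    first four hypotheses equate the squares of the images of \<open>a1\<close> and
    \<open>a2\<close>, the next three groups of four are the power relations of \<open>a1\<close>,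
    \<open>b1\<close> and \<open>b2\<close>, and the last eight are the two commutation
    relations.\<close>
  using assms unfolding even_add even_diff even_mult_iff even_minus
  (* simplifying between the case splits discards most branches early *)
  by (cases "even r1"; cases "even r2"; cases "even q1"; cases "even q2"; simp only: simp_thms;
    cases "even S1"; cases "even S2"; simp only: simp_thms;
    cases "even T1"; cases "even T2"; simp only: simp_thms;
    cases "even t1"; cases "even t2"; simp only: simp_thms;
    cases "even n1"; cases "even n2"; simp only: simp_thms;
    cases "even s1"; cases "even s2"; simp only: simp_thms;
    cases "even m1"; cases "even m2"; simp only: simp_thms)

text \<open>The qualified name is needed because the method \<open>algebra\<close> of HOL-Algebra hides the Groebner
  basis method.\<close>

lemma power_commutator_eqs:
  fixes P k :: int
  assumes "P dvd q1 + q2 + k*r1" "P dvd k*r2" "P dvd r1 - k*r1" "P dvd r1 + r2 - k*r2"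
  shows "P dvd r1" "P dvd r2" "P dvd q1 + q2"
  using assms by Groebner_Basis.algebra+

lemma endo_equations_linear:
  fixes P s1 s2 t1 t2 S1 S2 T1 T2 m1 m2 n1 n2 q1 q2 r1 r2 :: int
  assumes P: "prime P"
  and u: "P dvd s1 + s2 - (S1 + S2)" "P dvd t1 - T1" "P dvd t1+t2 - (T1+T2)"
  and a: "P dvd s1 + s2 - (s1*n1 - m1*t1)"
  "P dvd - (s1*n2-m1*t2)" "P dvd t1 - (s2*n1-m2*t1)" "P dvd t1+t2 - (s2*n2-m2*t2)"
  and b: "P dvd m1 + m2 - (S1*(n1+r1) - (m1+q1)*T1)"
  "P dvd - (S1*(n2+r2)-(m1+q1)*T2)" "P dvd n1 - (S2*(n1+r1)-(m2+q2)*T1)"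
    "P dvd n1+n2 - (S2*(n2+r2)-(m2+q2)*T2)"
  and c: "P dvd q1 + q2 - (S1*r1 - q1*T1)"
  "P dvd - (S1*r2-q1*T2)" "P dvd r1 - (S2*r1-q2*T1)" "P dvd r1+r2 - (S2*r2-q2*T2)"
  and d: "P dvd s1*T1-S1*t1"   "P dvd s1*T2-S1*t2"   "P dvd s2*T1-S2*t1"   "P dvd s2*T2-S2*t2"
  and e: "P dvd m1*r1-q1*n1"   "P dvd m1*r2-q1*n2"   "P dvd m2*r1-q2*n1"   "P dvd m2*r2-q2*n2"
  shows "(P dvd s1 - 1 \<and> P dvd s2 \<and> P dvd t1 \<and> P dvd t2 \<and> P dvd S1 \<and> P dvd S2 - 1 \<and> P dvd T1
    \<and> P dvd T2
    \<and> P dvd m1 \<and> P dvd m2 \<and> P dvd n1 - 1 \<and> P dvd n2 \<and> P dvd q1 \<and> P dvd q2 \<and> P dvd r1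
      \<and> P dvd r2 - 1) \<or>
   (P dvd s1+s2 \<and> P dvd S1+S2 \<and> P dvd m1+m2 \<and> P dvd q1+q2 \<and> P dvd t1 \<and> P dvd t2 \<and> P dvd T1
     \<and> P dvd T2
     \<and> P dvd n1 \<and> P dvd n2 \<and> P dvd r1 \<and> P dvd r2)"
proof (cases "P dvd t1 \<and> P dvd t2")
  case False
  have "P dvd (s1 - S1)*t1" "P dvd (s1 - S1)*t2" using u d by Groebner_Basis.algebra+
  then have s1: "P dvd s1 - S1" using False prime_dvd_mult_iff[OF P] by blast
  \<comment> \<open>The images of \<open>b1\<close> and \<open>a1 b2\<close> have the same p-th
    power, so modulo the center they differ by a multiple of \<open>kv\<close>; \<open>k\<close> is
    that multiple.\<close>
  define k where "k = m1 - S1 - q1"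
  have n: "P dvd n1 - t1 - r1" "P dvd n2 - t2 - r2" and m2: "P dvd m2 - (S2 + q2 - k)"
    using u a b c s1 unfolding k_def by Groebner_Basis.algebra+
  \<comment> \<open>Since the images of \<open>b1\<close> and \<open>b2\<close> commute, the
    relation for \<open>b2\<close> becomes \<open>powv q + k [kv, q] = 0\<close>. With
    \<open>q\<close> now of trivial power, the same equation follows below for the image of
    \<open>a1\<close>.\<close>
  have "P dvd q1 + q2 + k*r1" "P dvd k*r2" "P dvd r1 - k*r1" "P dvd r1 + r2 - k*r2"
    using u(2,3) c e n m2 unfolding k_def by Groebner_Basis.algebra+
  note r = power_commutator_eqs[OF this]
  have "P dvd s1 + s2 + k*t1" "P dvd k*t2" "P dvd t1 - k*t1" "P dvd t1 + t2 - k*t2"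
    using u a c r n m2 s1 unfolding k_def by Groebner_Basis.algebra+
  note t = power_commutator_eqs[OF this]
  then show ?thesis using False by blast
next
  case True
  then have T: "P dvd T1" "P dvd T2" using u by Groebner_Basis.algebra+
  have aa: "P dvd s1 + s2 - s1*n1" "P dvd s1*n2" "P dvd s2*n1" "P dvd s2*n2"
    using a True by Groebner_Basis.algebra+
  have cc: "P dvd q1 + q2 - S1*r1" "P dvd S1*r2" "P dvd r1 - S2*r1" "P dvd r1+r2 - S2*r2"
    using c T by Groebner_Basis.algebra+
  have bb: "P dvd m1 + m2 - S1*(n1+r1)" "P dvd S1*(n2+r2)" "P dvd n1 - S2*(n1+r1)"
    "P dvd n1 + n2 - S2*(n2+r2)"
    using b T by Groebner_Basis.algebra+
  show ?thesis
  proof (cases "P dvd r2")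
    case r2: True
    then have r1: "P dvd r1" and q: "P dvd q1 + q2" using cc by Groebner_Basis.algebra+
    have bb': "P dvd m1 + m2 - S1*n1" "P dvd S1*n2" "P dvd n1 - S2*n1" "P dvd n1 + n2 - S2*n2"
      using bb r1 r2 by Groebner_Basis.algebra+
    \<comment> \<open>Otherwise the images of \<open>a1\<close> and \<open>a2\<close> are central,
      so the power of the image of \<open>b1\<close> is trivial, which forces \<open>n1\<close> and
      \<open>n2\<close> to vanish.\<close>
    have n2: "P dvd n2"
    proof (rule ccontr)
      assume n2: "\<not> P dvd n2"
      then have "P dvd s1" "P dvd s2" "P dvd S1" using aa bb' prime_dvd_mult_iff[OF P] by blast+
      then have "P dvd S2" using u by Groebner_Basis.algebra
      then have "P dvd n1" "P dvd n2" using bb' by Groebner_Basis.algebra+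
      then show False using n2 by blast
    qed
    then have n1: "P dvd n1" and m: "P dvd m1 + m2" using bb' by Groebner_Basis.algebra+
    have s: "P dvd s1 + s2" using aa n1 by Groebner_Basis.algebra
    have "P dvd S1 + S2" using s u by Groebner_Basis.algebra
    then show ?thesis using r1 r2 n1 n2 m s q T True by blast
  next
    case r2: False
    have S1: "P dvd S1" using cc r2 prime_dvd_mult_iff[OF P] by blast
    \<comment> \<open>The last two congruences of \<open>cc\<close> say
      \<open>(S2 - 1) * r1 = 0\<close> and \<open>r1 = (S2 - 1) * r2\<close> modulo
      \<open>P\<close>.\<close>
    have "P dvd (S2 - 1) * ((S2 - 1) * r2)" using cc by Groebner_Basis.algebra
    then have S2: "P dvd S2 - 1" using r2 prime_dvd_mult_iff[OF P] by blast
    have r1: "P dvd r1" using cc S2 by Groebner_Basis.algebra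
    have n1: "P dvd n1 - r2" using bb S2 by Groebner_Basis.algebra
    have "\<not> P dvd n1"
    proof
      assume "P dvd n1"
      then have "P dvd r2" using n1 by Groebner_Basis.algebra
      then show False using r2 by blast
    qed
    then have s2: "P dvd s2" using aa prime_dvd_mult_iff[OF P] by blast
    have s1: "P dvd s1 - 1" using s2 S1 S2 u by Groebner_Basis.algebra
    have n11: "P dvd n1 - 1" and n2: "P dvd n2" and r22: "P dvd r2 - 1"
      using aa s1 s2 n1 by Groebner_Basis.algebra+
    have "P dvd m1" "P dvd m2" "P dvd q1" "P dvd q2"
      using e r1 r22 n11 n2 by Groebner_Basis.algebra+
    then show ?thesis using S1 S2 r1 r22 s1 s2 n11 n2 T True by blast
  qed
qed

text \<open>Here \<open>C\<close> stands for \<open>p choose 2\<close>, the exponent in \<open>(g h)\<^sup>p = g\<^sup>p h\<^sup>p [h, g]\<^sup>C\<close>; it disturbs the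
  linearity of the power map only for \<open>p = 2\<close>. The rows \<open>(s, t)\<close>, \<open>(S, T)\<close>, \<open>(m, n)\<close>, \<open>(q, r)\<close> are the
  exponents of the images of \<open>a\<^sub>1, a\<^sub>2, b\<^sub>1, b\<^sub>2\<close> modulo the center, and the hypotheses are the
  defining relations.\<close>

lemma endo_classification:
  fixes P C s1 s2 t1 t2 S1 S2 T1 T2 m1 m2 n1 n2 q1 q2 r1 r2 :: int
  assumes P: "prime P" and C: "P = 2 \<longrightarrow> C = 1" "P \<noteq> 2 \<longrightarrow> P dvd C"
  and a: "P dvd s1 + s2 - C*(s1*t1) - (s1*n1 - m1*t1)" "P dvd - (C*(s1*t2)) - (s1*n2-m1*t2)"
    "P dvd t1 - C*(s2*t1) - (s2*n1-m2*t1)" "P dvd t1+t2 - C*(s2*t2) - (s2*n2-m2*t2)"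
  and u: "P dvd S1 + S2 - C*(S1*T1) - (s1*n1 - m1*t1)" "P dvd - (C*(S1*T2)) - (s1*n2-m1*t2)"
    "P dvd T1 - C*(S2*T1) - (s2*n1-m2*t1)" "P dvd T1+T2 - C*(S2*T2) - (s2*n2-m2*t2)"
  and b: "P dvd m1 + m2 - C*(m1*n1) - (S1*(n1+r1) - (m1+q1)*T1)"
    "P dvd - (C*(m1*n2)) - (S1*(n2+r2)-(m1+q1)*T2)"
    "P dvd n1 - C*(m2*n1) - (S2*(n1+r1)-(m2+q2)*T1)"
      "P dvd n1+n2 - C*(m2*n2) - (S2*(n2+r2)-(m2+q2)*T2)"
  and c: "P dvd q1 + q2 - C*(q1*r1) - (S1*r1 - q1*T1)" "P dvd - (C*(q1*r2)) - (S1*r2-q1*T2)"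
    "P dvd r1 - C*(q2*r1) - (S2*r1-q2*T1)" "P dvd r1+r2 - C*(q2*r2) - (S2*r2-q2*T2)"
  and d: "P dvd s1*T1-S1*t1" "P dvd s1*T2-S1*t2" "P dvd s2*T1-S2*t1" "P dvd s2*T2-S2*t2"
  and e: "P dvd m1*r1-q1*n1" "P dvd m1*r2-q1*n2" "P dvd m2*r1-q2*n1" "P dvd m2*r2-q2*n2"
  shows "(P dvd s1 - 1 \<and> P dvd s2 \<and> P dvd t1 \<and> P dvd t2 \<and> P dvd S1 \<and> P dvd S2 - 1 \<and> P dvd T1
    \<and> P dvd T2
    \<and> P dvd m1 \<and> P dvd m2 \<and> P dvd n1 - 1 \<and> P dvd n2 \<and> P dvd q1 \<and> P dvd q2 \<and> P dvd r1
      \<and> P dvd r2 - 1) \<or>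
   (P dvd s1+s2 \<and> P dvd S1+S2 \<and> P dvd m1+m2 \<and> P dvd q1+q2 \<and> P dvd t1 \<and> P dvd t2 \<and> P dvd T1
     \<and> P dvd T2
     \<and> P dvd n1 \<and> P dvd n2 \<and> P dvd r1 \<and> P dvd r2)"
proof (cases "P = 2")
  case True
  \<comment> \<open>The power relations of \<open>a1\<close> and \<open>a2\<close> share the
    right-hand side \<open>[a1, b1]\<close>, which cancels on subtraction.\<close>
  have sub: "2 dvd x - z \<Longrightarrow> 2 dvd y - z \<Longrightarrow> 2 dvd x - y" for x y z :: int by presburger
  have diff: "even (s1 + s2 - s1*t1 - (S1 + S2 - S1*T1))" "even (s1*t2 - S1*T2)"
    "even (t1 - s2*t1 - (T1 - S2*T1))" "even (t1+t2-s2*t2 - (T1+T2-S2*T2))"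
    using sub[OF a(1)[unfolded True] u(1)[unfolded True]] sub[OF a(2)[unfolded True]
      u(2)[unfolded True]]
      sub[OF a(3)[unfolded True] u(3)[unfolded True]] sub[OF a(4)[unfolded True]
        u(4)[unfolded True]]
    by (simp_all add: C[rule_format] True)
  show ?thesis
    using endo_equations_2[OF diff, of n1 m1 n2 m2 r1 q1 r2 q2] a b c d e unfolding True C(1)[rule_format, OF True] by simp
next
  case False
  then have PC: "P dvd C" using C(2) by blast
  have drop: "P dvd x - C * y - z \<longleftrightarrow> P dvd x - z" for x y z
  proof -
    have "x - C * y - z = (x - z) + (- C) * y" by simp
    moreover have "P dvd (- C) * y" using PC by simp
    ultimately show ?thesis by (metis dvd_add_left_iff)
  qed
  have drop': "P dvd - (C * y) - z \<longleftrightarrow> P dvd - z" for y z using drop[of 0 y z] by simp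
  have sub: "P dvd x - z \<Longrightarrow> P dvd y - z \<Longrightarrow> P dvd x - y" for x y z :: int
    by (metis diff_diff_eq2 dvd_diff diff_add_cancel)
  note dr = drop drop'
  have u3: "P dvd t1 - T1" by (rule sub[OF a(3)[unfolded dr] u(3)[unfolded dr]])
  have u4: "P dvd t1 + t2 - (T1 + T2)" by (rule sub[OF a(4)[unfolded dr] u(4)[unfolded dr]])
  have u1: "P dvd s1 + s2 - (S1 + S2)" by (rule sub[OF a(1)[unfolded dr] u(1)[unfolded dr]])
  show ?thesis
    by (rule endo_equations_linear[OF P u1 u3 u4 a[unfolded dr] b[unfolded dr]
      c[unfolded dr] d e])
qed

subsection \<open>Words and homomorphisms from presented groups\<close>

definition word_eval :: "('a, 'b) monoid_scheme \<Rightarrow> ('x \<Rightarrow> 'a) \<Rightarrow> 'x gword \<Rightarrow> 'a" where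
  "word_eval H f w = foldr (\<lambda>(x, e) a. (if e then f x else inv\<^bsub>H\<^esub> f x) \<otimes>\<^bsub>H\<^esub> a) w \<one>\<^bsub>H\<^esub>"

lemma (in group) commutator_closed [simp]:
  "\<lbrakk>x \<in> carrier G; y \<in> carrier G\<rbrakk> \<Longrightarrow> commutator G x y \<in> carrier G"
  by (simp add: commutator_def)

lemma (in group) commutator_eq_iff:
  assumes "x \<in> carrier G" "y \<in> carrier G" "c \<in> carrier G"
  shows "commutator G x y = c \<longleftrightarrow> x \<otimes> y = y \<otimes> x \<otimes> c"
proof -
  have "commutator G x y = inv (y \<otimes> x) \<otimes> (x \<otimes> y)"
    using assms by (simp add: commutator_def inv_mult_group m_assoc)
  then show ?thesis using assms by (metis inv_solve_left m_closed)
qed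

lemma (in group) commutator_eq_one_iff:
  assumes "x \<in> carrier G" "y \<in> carrier G"
  shows "commutator G x y = \<one> \<longleftrightarrow> x \<otimes> y = y \<otimes> x"
  using commutator_eq_iff[OF assms one_closed] assms by simp

lemma (in group_hom) hom_commutator:
  "\<lbrakk>x \<in> carrier G; y \<in> carrier G\<rbrakk> \<Longrightarrow> h (commutator G x y) = commutator H (h x) (h y)"
  by (simp add: commutator_def)

lemma pres_class_closed [simp]: "pres_class R w \<in> carrier (presented_group R)"
  by (simp add: presented_group_def)

lemma presented_groupE:
  assumes "X \<in> carrier (presented_group R)"
  obtains w where "X = pres_class R w"
  using assms by (auto simp: presented_group_def)

context group
begin

context
  fixes f :: "'x \<Rightarrow> 'a"
  assumes f: "\<And>x. f x \<in> carrier G"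
begin

lemma word_eval_Nil [simp]: "word_eval G f [] = \<one>"
  by (simp add: word_eval_def)

lemma word_eval_Cons:
  "word_eval G f ((x, e) # w) = (if e then f x else inv f x) \<otimes> word_eval G f w"
  by (simp add: word_eval_def)

lemma word_eval_closed [simp]: "word_eval G f w \<in> carrier G"
  by (induction w) (auto simp: word_eval_Cons f)

lemma word_eval_letter [simp]: "word_eval G f [(x, True)] = f x"
  by (simp add: word_eval_Cons f)

lemma word_eval_append [simp]: "word_eval G f (u @ v) = word_eval G f u \<otimes> word_eval G f v"
  by (induction u) (auto simp: word_eval_Cons f m_assoc)

lemma word_eval_inv [simp]: "word_eval G f (word_inv w) = inv word_eval G f w"
  by (induction w) (auto simp: word_inv_def word_eval_Cons f inv_mult_group)

lemma word_eval_pow [simp]: "word_eval G f (word_pow w n) = word_eval G f w [^] n"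
proof (induction n)
  case (Suc n)
  then show ?case
    using nat_pow_Suc2[OF word_eval_closed[of w], of n] by (simp add: word_pow_def)
qed (simp add: word_pow_def)

lemma word_eval_comm [simp]:
  "word_eval G f (word_comm u v) = commutator G (word_eval G f u) (word_eval G f v)"
  by (simp add: word_comm_def commutator_def m_assoc)

lemma word_eval_pres_eq:
  assumes R: "\<And>u v. (u, v) \<in> R \<Longrightarrow> word_eval G f u = word_eval G f v"
    and "pres_eq R u v"
  shows "word_eval G f u = word_eval G f v"
  using assms(2)
proof induction
  case (pres_rel u v)
  then show ?case by (rule R)
qed (simp_all add: word_eval_Cons f)

lemma presented_group_lift:
  assumes R: "\<And>u v. (u, v) \<in> R \<Longrightarrow> word_eval G f u = word_eval G f v"
  shows "\<exists>h\<in>hom (presented_group R) G. \<forall>w. h (pres_class R w) = word_eval G f w"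
proof -
  define h where "h X = word_eval G f (SOME w. w \<in> X)" for X
  have h: "h (pres_class R w) = word_eval G f w" for w
  proof -
    have "w \<in> pres_class R w" by (simp add: pres_class_def pres_refl)
    then have "(SOME u. u \<in> pres_class R w) \<in> pres_class R w" by (rule someI)
    then show ?thesis using word_eval_pres_eq[OF R] by (simp add: h_def pres_class_def)
  qed
  moreover have "h \<in> hom (presented_group R) G"
    by (auto intro!: homI elim!: presented_groupE simp: pres_class_mult h)
  ultimately show ?thesis by blast
qed

end

end

lemma hom_presented_group:
  assumes "group H" "h \<in> hom (presented_group R) H"
  shows "h (pres_class R w) = word_eval H (\<lambda>x. h (pres_class R [(x, True)])) w"
proof -
  interpret P: group "presented_group R" by (rule group_presented_group)
  interpret group_hom "presented_group R" H h
    using assms by (simp add: group_hom_def group_hom_axioms_def group_presented_group)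
  have one: "\<one>\<^bsub>presented_group R\<^esub> = pres_class R []" by (simp add: presented_group_def)
  have inv: "inv\<^bsub>presented_group R\<^esub> pres_class R [(x, True)] = pres_class R [(x, False)]" for x
  proof (rule P.inv_equality)
    show "pres_class R [(x, False)] \<otimes>\<^bsub>presented_group R\<^esub> pres_class R [(x, True)] = \<one>\<^bsub>presented_group R\<^esub>"
      using pres_cancel[of R x False] by (simp add: pres_class_mult one pres_class_eq_iff)
  qed simp_all
  show ?thesis
  proof (induction w)
    case Nil
    then show ?case using hom_one by (simp add: one word_eval_def)
  next
    case (Cons l w)
    obtain x e where l: "l = (x, e)" by (cases l)
    have neg: "h (pres_class R [(x, False)]) = inv\<^bsub>H\<^esub> h (pres_class R [(x, True)])"
      using hom_inv[OF pres_class_closed[where w = "[(x, True)]"]] unfolding inv .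
    have letter: "h (pres_class R [(x, e)]) = (if e then h (pres_class R [(x, True)])
        else inv\<^bsub>H\<^esub> h (pres_class R [(x, True)]))"
      using neg by (cases e) auto
    have "pres_class R (l # w) = pres_class R [l] \<otimes>\<^bsub>presented_group R\<^esub> pres_class R w"
      unfolding pres_class_mult by simp
    then have "h (pres_class R (l # w)) = h (pres_class R [l]) \<otimes>\<^bsub>H\<^esub> h (pres_class R w)"
      using hom_mult[OF pres_class_closed pres_class_closed] by metis
    also have "\<dots> = word_eval H (\<lambda>x. h (pres_class R [(x, True)])) (l # w)"
      unfolding l letter Cons.IH by (simp only: word_eval_def foldr.simps comp_def prod.case)
    finally show ?case .
  qed
qed

text \<open>\<open>hom_presented_group\<close> at the identity map. It turns congruences of words
  into equations between evaluated words in the group.\<close>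

lemma pres_class_eval:
  "pres_class R w = word_eval (presented_group R) (\<lambda>x. pres_class R [(x, True)]) w"
  using hom_presented_group[OF group_presented_group, of "\<lambda>x. x" R R w]
  by (simp add: hom_def)

lemma hom_presented_group_eqI:
  assumes "group H" "h \<in> hom (presented_group R) H" "k \<in> hom (presented_group R) H"
    and "\<And>x. h (pres_class R [(x, True)]) = k (pres_class R [(x, True)])"
    and "X \<in> carrier (presented_group R)"
  shows "h X = k X"
proof -
  obtain w where "X = pres_class R w" using assms(5) by (rule presented_groupE)
  then show ?thesis
    using hom_presented_group[OF assms(1,2), of w] hom_presented_group[OF assms(1,3), of w]
    by (simp only: assms(4))
qed

subsection \<open>Commutation of powers\<close>

context group
begin

lemma inv_cancel_left:
  assumes "x \<in> carrier G" "y \<in> carrier G"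
  shows "inv x \<otimes> (x \<otimes> y) = y" "x \<otimes> (inv x \<otimes> y) = y"
  using assms by (simp_all flip: m_assoc)

lemma m_exchange:
  assumes "b \<otimes> c = c \<otimes> b" "a \<in> carrier G" "b \<in> carrier G" "c \<in> carrier G" "d \<in> carrier G"
  shows "(a \<otimes> b) \<otimes> (c \<otimes> d) = (a \<otimes> c) \<otimes> (b \<otimes> d)"
proof -
  have "(a \<otimes> b) \<otimes> (c \<otimes> d) = a \<otimes> (b \<otimes> c) \<otimes> d" using assms(2-5) by (simp add: m_assoc)
  also have "\<dots> = a \<otimes> (c \<otimes> b) \<otimes> d" using assms(1) by simp
  finally show ?thesis using assms(2-5) by (simp add: m_assoc)
qed

lemma group_center_closed: "z \<in> group_center G \<Longrightarrow> z \<in> carrier G"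
  by (simp add: group_center_def)

lemma group_centerI:
  "\<lbrakk>z \<in> carrier G; \<And>g. g \<in> carrier G \<Longrightarrow> z \<otimes> g = g \<otimes> z\<rbrakk> \<Longrightarrow> z \<in> group_center G"
  unfolding group_center_def by blast

lemma group_center_commutes:
  "\<lbrakk>z \<in> group_center G; g \<in> carrier G\<rbrakk> \<Longrightarrow> z \<otimes> g = g \<otimes> z"
  by (simp add: group_center_def)

lemma subgroup_group_center: "subgroup (group_center G) G"
proof (rule subgroupI)
  show "a \<otimes> b \<in> group_center G" if ab: "a \<in> group_center G" "b \<in> group_center G" for a b
  proof -
    have "(a \<otimes> b) \<otimes> g = g \<otimes> (a \<otimes> b)" if g: "g \<in> carrier G" for g
    proof -
      have "(a \<otimes> b) \<otimes> g = a \<otimes> (b \<otimes> g)"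
        using ab g by (simp add: m_assoc group_center_closed)
      also have "b \<otimes> g = g \<otimes> b" by (rule group_center_commutes[OF ab(2) g])
      also have "a \<otimes> (g \<otimes> b) = (a \<otimes> g) \<otimes> b"
        using ab g by (simp add: m_assoc group_center_closed)
      also have "a \<otimes> g = g \<otimes> a" by (rule group_center_commutes[OF ab(1) g])
      finally show ?thesis using ab g by (simp add: m_assoc group_center_closed)
    qed
    then show ?thesis
      by (rule group_centerI[OF m_closed[OF group_center_closed[OF ab(1)] group_center_closed[OF ab(2)]]])
  qed
  show "inv a \<in> group_center G" if a: "a \<in> group_center G" for a
  proof -
    have "inv a \<otimes> g = g \<otimes> inv a" if g: "g \<in> carrier G" for g
    proof -
      have "inv a \<otimes> g = inv a \<otimes> (g \<otimes> a) \<otimes> inv a"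
        using a g by (simp add: m_assoc group_center_closed)
      also have "g \<otimes> a = a \<otimes> g" by (rule group_center_commutes[OF a g, symmetric])
      finally show ?thesis using a g by (simp add: m_assoc inv_cancel_left group_center_closed)
    qed
    then show ?thesis by (rule group_centerI[OF inv_closed[OF group_center_closed[OF a]]])
  qed
next
  show "group_center G \<subseteq> carrier G" using group_center_closed by blast
  have "\<one> \<in> group_center G" by (rule group_centerI) simp_all
  then show "group_center G \<noteq> {}" by blast
qed

text \<open>Conjugation by \<open>b\<close> is a homomorphism taking \<open>a\<close> to
  \<open>a c\<close>, so it takes \<open>a^s\<close> to \<open>(a c)^s\<close>, which splits because
  \<open>c\<close> is central.\<close>

lemma int_pow_swap_left:
  assumes "a \<in> carrier G" "b \<in> carrier G" "c \<in> group_center G" "a \<otimes> b = b \<otimes> a \<otimes> c"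
  shows "a [^] (s::int) \<otimes> b = b \<otimes> a [^] s \<otimes> c [^] s"
proof -
  note c = group_center_closed[OF assms(3)]
  have "(\<lambda>x. inv b \<otimes> x \<otimes> b) \<in> hom G G"
    using assms(2) by (auto intro!: homI simp: m_assoc inv_cancel_left)
  then have "inv b \<otimes> a [^] s \<otimes> b = (inv b \<otimes> a \<otimes> b) [^] s"
    using hom_int_pow[of "\<lambda>x. inv b \<otimes> x \<otimes> b" G G a s] assms group_axioms by simp
  also have "inv b \<otimes> a \<otimes> b = a \<otimes> c"
    using assms c by (simp add: m_assoc inv_cancel_left)
  also have "(a \<otimes> c) [^] s = a [^] s \<otimes> c [^] s"
    using group_center_commutes[OF assms(3,1)] assms(1) c
      by (intro int_pow_mult_distrib) (rule sym)
  finally have conj: "inv b \<otimes> a [^] s \<otimes> b = a [^] s \<otimes> c [^] s" .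
  have "a [^] s \<otimes> b = b \<otimes> (inv b \<otimes> a [^] s \<otimes> b)"
    using assms by (simp add: m_assoc inv_cancel_left)
  then show ?thesis using assms c conj by (simp add: m_assoc)
qed

text \<open>\<open>int_pow_swap_left\<close> used twice, the second time for \<open>b\<close> and
  \<open>a^s\<close>, whose commutator is \<open>c^(-s)\<close>.\<close>

lemma int_pow_swap:
  assumes "a \<in> carrier G" "b \<in> carrier G" "c \<in> group_center G" "a \<otimes> b = b \<otimes> a \<otimes> c"
  shows "b [^] (t::int) \<otimes> a [^] (s::int) = a [^] s \<otimes> b [^] t \<otimes> c [^] (- (s * t))"
proof -
  note c = group_center_closed[OF assms(3)]
  have cs: "c [^] i \<in> group_center G" for i :: int
    by (rule subgroup_int_pow_closed[OF subgroup_group_center assms(3)])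
  have "a [^] s \<otimes> b \<otimes> c [^] (- s) = b \<otimes> a [^] s \<otimes> (c [^] s \<otimes> c [^] (- s))"
    unfolding int_pow_swap_left[OF assms, of s] using assms(1,2) c by (simp add: m_assoc)
  then have "b \<otimes> a [^] s = a [^] s \<otimes> b \<otimes> c [^] (- s)"
    using assms(1,2) c by (simp flip: int_pow_mult)
  from int_pow_swap_left[OF assms(2) int_pow_closed[OF assms(1)] cs this, of t] show ?thesis
    using c by (simp add: int_pow_pow)
qed

text \<open>This and \<open>swap_mult_right\<close> are the bilinearity of commutators in class 2,
  phrased as rewriting of products so that the collection in \<open>nfB_nfA\<close> can chain
  them.\<close>

lemma swap_mult_left:
  assumes "x \<otimes> y = y \<otimes> x \<otimes> c" "x' \<otimes> y = y \<otimes> x' \<otimes> c'"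
    and "x \<in> carrier G" "x' \<in> carrier G" "y \<in> carrier G" "c \<in> group_center G"
      "c' \<in> group_center G"
  shows "(x \<otimes> x') \<otimes> y = y \<otimes> (x \<otimes> x') \<otimes> (c \<otimes> c')"
proof -
  note c = group_center_closed[OF assms(6)] group_center_closed[OF assms(7)]
  have "(x \<otimes> x') \<otimes> y = x \<otimes> (x' \<otimes> y)" using assms(3-5) by (simp add: m_assoc)
  also have "\<dots> = (x \<otimes> y) \<otimes> x' \<otimes> c'" unfolding assms(2) using assms(3-5) c by (simp add: m_assoc)
  also have "\<dots> = y \<otimes> x \<otimes> (c \<otimes> x') \<otimes> c'" unfolding assms(1) using assms(3-5) c
    by (simp add: m_assoc)
  also have "c \<otimes> x' = x' \<otimes> c" by (rule group_center_commutes[OF assms(6,4)])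
  finally show ?thesis using assms(3-5) c by (simp add: m_assoc)
qed

lemma swap_mult_right:
  assumes "x \<otimes> y = y \<otimes> x \<otimes> c" "x \<otimes> y' = y' \<otimes> x \<otimes> c'"
    and "x \<in> carrier G" "y' \<in> carrier G" "y \<in> carrier G" "c \<in> group_center G"
      "c' \<in> group_center G"
  shows "x \<otimes> (y \<otimes> y') = (y \<otimes> y') \<otimes> x \<otimes> (c \<otimes> c')"
proof -
  note c = group_center_closed[OF assms(6)] group_center_closed[OF assms(7)]
  have "x \<otimes> (y \<otimes> y') = x \<otimes> y \<otimes> y'" using assms(3-5) by (simp add: m_assoc)
  also have "\<dots> = y \<otimes> x \<otimes> (c \<otimes> y')" unfolding assms(1) using assms(3-5) c by (simp add: m_assoc)
  also have "c \<otimes> y' = y' \<otimes> c" by (rule group_center_commutes[OF assms(6,4)])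
  also have "y \<otimes> x \<otimes> (y' \<otimes> c) = y \<otimes> (x \<otimes> y') \<otimes> c"
    using assms(3-5) c by (simp add: m_assoc)
  also have "\<dots> = y \<otimes> y' \<otimes> x \<otimes> (c' \<otimes> c)"
    unfolding assms(2) using assms(3-5) c by (simp add: m_assoc)
  also have "c' \<otimes> c = c \<otimes> c'" by (rule group_center_commutes[OF assms(7) c(1)])
  finally show ?thesis .
qed

end

subsection \<open>The integral group\<close>

definition vec4 :: "'a \<Rightarrow> 'a \<Rightarrow> 'a \<Rightarrow> 'a \<Rightarrow> 'a ^ 4" where
  "vec4 a b c d = (\<chi> i. if i = 1 then a else if i = 2 then b else if i = 3 then c else d)"

lemma vec4_nth [simp]:
  "vec4 a b c d $ 1 = a" "vec4 a b c d $ 2 = b" "vec4 a b c d $ 3 = c" "vec4 a b c d $ 4 = d"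
  by (simp_all add: vec4_def)

lemma vec4_eq_iff: "(v :: 'a ^ 4) = w \<longleftrightarrow> v $ 1 = w $ 1 \<and> v $ 2 = w $ 2 \<and> v $ 3 = w $ 3 \<and> v $ 4 = w $ 4"
  by (simp add: vec_eq_iff forall_4)

text \<open>\<open>bil x y\<close> is the central part of \<open>b\<^sub>1\<^bsup>x\<^sub>3\<^esup> b\<^sub>2\<^bsup>x\<^sub>4\<^esup> \<cdot> a\<^sub>1\<^bsup>y\<^sub>1\<^esup> a\<^sub>2\<^bsup>y\<^sub>2\<^esup>\<close>
  after collecting the \<open>a\<close>-part on the left.\<close>

definition bil :: "int ^ 4 \<Rightarrow> int ^ 4 \<Rightarrow> int ^ 4" where
  "bil x y = vec4 (- (y $ 1 * x $ 3)) (- (y $ 1 * x $ 4)) (- (y $ 2 * x $ 3)) (- (y $ 2 * x $ 4))"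

text \<open>The coordinates of the \<open>p\<close>-th powers of the generators, extended linearly.\<close>

definition powv :: "int ^ 4 \<Rightarrow> int ^ 4" where
  "powv x = vec4 (x $ 1 + x $ 2) 0 (x $ 3) (x $ 3 + x $ 4)"

definition hat :: "((int ^ 4) \<times> (int ^ 4)) monoid" where
  "hat = \<lparr>carrier = UNIV, monoid.mult = (\<lambda>(x, z) (y, w). (x + y, z + w + bil x y)), one = (0, 0)\<rparr>"

lemma carrier_hat [simp]: "carrier hat = UNIV"
  and mult_hat [simp]: "(x, z) \<otimes>\<^bsub>hat\<^esub> (y, w) = (x + y, z + w + bil x y)"
  and one_hat [simp]: "\<one>\<^bsub>hat\<^esub> = (0, 0)"
  by (simp_all add: hat_def)

lemma bil_add:
  "bil (x + x') y = bil x y + bil x' y" "bil x (y + y') = bil x y + bil x y'"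
  by (simp_all add: vec4_eq_iff bil_def algebra_simps)

lemma bil_uminus: "bil (- x) y = - bil x y" "bil x (- y) = - bil x y"
  by (simp_all add: vec4_eq_iff bil_def)

lemma bil_smult: "bil (k *s x) y = k *s bil x y" "bil x (k *s y) = k *s bil x y"
  by (simp_all add: vec4_eq_iff bil_def)

lemma bil_0 [simp]: "bil 0 y = 0" "bil x 0 = 0"
  by (simp_all add: vec4_eq_iff bil_def)

interpretation hat: group hat
proof (rule groupI)
  fix e e' e'' :: "(int ^ 4) \<times> (int ^ 4)"
  show "e \<otimes>\<^bsub>hat\<^esub> e' \<otimes>\<^bsub>hat\<^esub> e'' = e \<otimes>\<^bsub>hat\<^esub> (e' \<otimes>\<^bsub>hat\<^esub> e'')"
    by (cases e; cases e'; cases e'') (simp add: bil_add algebra_simps)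
  show "\<one>\<^bsub>hat\<^esub> \<otimes>\<^bsub>hat\<^esub> e = e" by (cases e) simp
  have "(- fst e, bil (fst e) (fst e) - snd e) \<otimes>\<^bsub>hat\<^esub> e = \<one>\<^bsub>hat\<^esub>"
    by (cases e) (simp add: bil_uminus)
  then show "\<exists>e'\<in>carrier hat. e' \<otimes>\<^bsub>hat\<^esub> e = \<one>\<^bsub>hat\<^esub>" by (metis carrier_hat UNIV_I)
qed simp_all

lemma inv_hat [simp]: "inv\<^bsub>hat\<^esub> (x, z) = (- x, bil x x - z)"
  by (rule hat.inv_equality) (simp_all add: bil_uminus)

lemma commutator_hat [simp]: "commutator hat (x, z) (y, w) = (0, bil x y - bil y x)"
  by (simp add: commutator_def bil_def vec4_eq_iff algebra_simps)

lemma nat_pow_hat: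
  "(x, z) [^]\<^bsub>hat\<^esub> n = (int n *s x, int n *s z + int (n choose 2) *s bil x x)"
proof (induction n)
  case 0
  show ?case by (simp add: vec4_eq_iff)
next
  case (Suc n)
  have "Suc n choose 2 = n + (n choose 2)" by (simp add: numeral_2_eq_2)
  then show ?case using Suc by (simp add: vec4_eq_iff bil_smult algebra_simps)
qed

text \<open>The hypothesis removes the binomial term of \<open>nat_pow_hat\<close>, so one formula
  serves exponents of both signs. Generators, multiples of \<open>kv\<close> and central elements
  all satisfy it.\<close>

lemma int_pow_hat:
  assumes "bil x x = 0"
  shows "(x, z) [^]\<^bsub>hat\<^esub> (i::int) = (i *s x, i *s z)"
proof (cases "0 \<le> i")
  case True
  then obtain n where "i = int n" using nonneg_int_cases by blast
  then show ?thesis using assms by (simp add: int_pow_int nat_pow_hat)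
next
  case False
  then obtain n where "i = - int n" by (metis int_cases2 nle_le of_nat_0_le_iff)
  then show ?thesis using assms
    by (simp add: hat.int_pow_neg int_pow_int nat_pow_hat bil_smult vec4_eq_iff)
qed

definition hat_gen :: "generator \<Rightarrow> (int ^ 4) \<times> (int ^ 4)" where
  "hat_gen x = (case x of A1 \<Rightarrow> vec4 1 0 0 0 | A2 \<Rightarrow> vec4 0 1 0 0 | B1 \<Rightarrow> vec4 0 0 1 0 | B2 \<Rightarrow> vec4 0 0 0 1, 0)"

lemma hat_gen_simps:
  "hat_gen A1 = (vec4 1 0 0 0, 0)" "hat_gen A2 = (vec4 0 1 0 0, 0)"
  "hat_gen B1 = (vec4 0 0 1 0, 0)" "hat_gen B2 = (vec4 0 0 0 1, 0)"
  by (simp_all add: hat_gen_def)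

lemma hat_gen_pow: "hat_gen g [^]\<^bsub>hat\<^esub> (i::int) = (i *s fst (hat_gen g), 0)"
proof -
  have "bil (fst (hat_gen g)) (fst (hat_gen g)) = 0"
    by (cases g) (simp_all add: hat_gen_def bil_def vec4_eq_iff)
  from int_pow_hat[OF this, of 0 i] show ?thesis by (simp add: hat_gen_def)
qed

text \<open>A homomorphism is evaluated on this expression from its values at the generators alone;
  \<open>hom_coset\<close> compares \<open>h (nf e)\<close> with the coset of \<open>e\<close> in
  this way.\<close>

lemma hat_normal_form:
  "(x, z) =
    (hat_gen A1 [^]\<^bsub>hat\<^esub> (x $ 1) \<otimes>\<^bsub>hat\<^esub> hat_gen A2 [^]\<^bsub>hat\<^esub> (x $ 2)) \<otimes>\<^bsub>hat\<^esub>
    (hat_gen B1 [^]\<^bsub>hat\<^esub> (x $ 3) \<otimes>\<^bsub>hat\<^esub> hat_gen B2 [^]\<^bsub>hat\<^esub> (x $ 4)) \<otimes>\<^bsub>hat\<^esub>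
    (commutator hat (hat_gen A1) (hat_gen B1) [^]\<^bsub>hat\<^esub> (z $ 1) \<otimes>\<^bsub>hat\<^esub>
     commutator hat (hat_gen A1) (hat_gen B2) [^]\<^bsub>hat\<^esub> (z $ 2) \<otimes>\<^bsub>hat\<^esub>
     commutator hat (hat_gen A2) (hat_gen B1) [^]\<^bsub>hat\<^esub> (z $ 3) \<otimes>\<^bsub>hat\<^esub>
     commutator hat (hat_gen A2) (hat_gen B2) [^]\<^bsub>hat\<^esub> (z $ 4))"
  unfolding hat_gen_pow
  by (simp add: hat_gen_simps int_pow_hat) (simp add: vec4_eq_iff bil_def)

text \<open>The summand \<open>p v\<close> gives the central coordinates exponent \<open>p\<close>.
  The pair \<open>(p t, 0)\<close> is the ordered product of p-th powers of generators, not the p-th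
  power of \<open>(t, 0)\<close>; hence its value \<open>powv t\<close> is linear in
  \<open>t\<close> even for \<open>p = 2\<close>.\<close>

definition relN :: "nat \<Rightarrow> ((int ^ 4) \<times> (int ^ 4)) set" where
  "relN p = {(int p *s t, int p *s v - powv t) | t v. True}"

lemma relN_I: "x = int p *s t \<Longrightarrow> z = int p *s v - powv t \<Longrightarrow> (x, z) \<in> relN p"
  by (auto simp: relN_def)

text \<open>By bilinearity, products, inverses and conjugates of pairs with first component
  \<open>p t\<close> pick up only multiples of \<open>p\<close> in the second; the witnesses for
  \<open>v\<close> are these multiples divided by \<open>p\<close>.\<close>

lemma normal_relN: "relN p \<lhd> hat"
proof (rule hat.normal_invI)
  show "subgroup (relN p) hat"
  proof (rule hat.subgroupI)
    show "relN p \<noteq> {}" by (auto simp: relN_def)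
  next
    fix e assume "e \<in> relN p"
    then obtain t v where "e = (int p *s t, int p *s v - powv t)" by (auto simp: relN_def)
    then show "inv\<^bsub>hat\<^esub> e \<in> relN p"
      by (auto intro!: relN_I[where t = "- t" and v = "int p *s bil t t - v"]
          simp: bil_smult vec4_eq_iff powv_def algebra_simps)
  next
    fix e e' assume "e \<in> relN p" "e' \<in> relN p"
    then obtain t v t' v' where "e = (int p *s t, int p *s v - powv t)"
      "e' = (int p *s t', int p *s v' - powv t')" by (auto simp: relN_def)
    then show "e \<otimes>\<^bsub>hat\<^esub> e' \<in> relN p"
      by (auto intro!: relN_I[where t = "t + t'" and v = "v + v' + int p *s bil t t'"]
          simp: bil_smult vec4_eq_iff powv_def algebra_simps)
  qed simp
next
  fix e n :: "(int ^ 4) \<times> (int ^ 4)" assume "n \<in> relN p"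
  then obtain t v where n: "n = (int p *s t, int p *s v - powv t)" by (auto simp: relN_def)
  obtain x z where e: "e = (x, z)" by (cases e)
  show "e \<otimes>\<^bsub>hat\<^esub> n \<otimes>\<^bsub>hat\<^esub> inv\<^bsub>hat\<^esub> e \<in> relN p"
    unfolding e n
    by (auto intro!: relN_I[where t = t and v = "v + bil x t - bil t x"]
        simp: bil_smult bil_add bil_uminus vec4_eq_iff powv_def algebra_simps)
qed

lemma relN_coset_eq_iff:
  "relN p #>\<^bsub>hat\<^esub> (x, z) = relN p #>\<^bsub>hat\<^esub> (y, w) \<longleftrightarrow>
    (\<exists>t v. x = y + int p *s t \<and> z = w - powv t + int p *s v)"
proof -
  interpret N: normal "relN p" hat by (rule normal_relN)
  have "relN p #>\<^bsub>hat\<^esub> (x, z) = relN p #>\<^bsub>hat\<^esub> (y, w) \<longleftrightarrow> (x, z) \<in> relN p #>\<^bsub>hat\<^esub> (y, w)"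
    using hat.rcos_self[OF _ N.subgroup_axioms, of "(x, z)"]
      hat.repr_independence[OF _ _ N.subgroup_axioms, of "(x, z)" "(y, w)"] by auto
  also have "\<dots> \<longleftrightarrow> (x, z) \<otimes>\<^bsub>hat\<^esub> inv\<^bsub>hat\<^esub> (y, w) \<in> relN p"
    using N.rcos_module[OF hat.is_group, of "(y, w)" "(x, z)"] by simp
  also have "\<dots> \<longleftrightarrow> (\<exists>t v. x - y = int p *s t \<and> z + (bil y y - w) + bil x (- y) = int p *s v - powv t)"
    by (auto simp: relN_def)
  also have "\<dots> \<longleftrightarrow> (\<exists>t v. x = y + int p *s t \<and> z = w - powv t + int p *s v)"
  proof (rule ex_cong1, rule iffI)
    fix t
    assume "\<exists>v. x - y = int p *s t \<and> z + (bil y y - w) + bil x (- y) = int p *s v - powv t"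
    then obtain v where v: "x = y + int p *s t"
      "z + (bil y y - w) + bil x (- y) = int p *s v - powv t"
      by (auto simp: algebra_simps)
    \<comment> \<open>The cocycle contributes \<open>p\<close> times \<open>bil t y\<close>, which
      the free parameter \<open>v\<close> absorbs.\<close>
    from v(2) have "z = w - powv t + int p *s (v + bil t y)"
      unfolding v(1) by (simp add: bil_add bil_uminus bil_smult vec4_eq_iff algebra_simps)
    with v(1) show "\<exists>v. x = y + int p *s t \<and> z = w - powv t + int p *s v" by blast
  next
    fix t
    assume "\<exists>v. x = y + int p *s t \<and> z = w - powv t + int p *s v"
    then obtain v where v: "x = y + int p *s t" "z = w - powv t + int p *s v" by blast
    have "x - y = int p *s t \<and>
      z + (bil y y - w) + bil x (- y) = int p *s (v - bil t y) - powv t"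
      unfolding v by (simp add: bil_add bil_uminus bil_smult vec4_eq_iff algebra_simps)
    then show "\<exists>v. x - y = int p *s t \<and> z + (bil y y - w) + bil x (- y) = int p *s v - powv t"
      by blast
  qed
  finally show ?thesis .
qed

subsection \<open>The universal property and the relations of the group\<close>

lemma group_G: "group (G p)"
  unfolding G_def by (rule group_presented_group)

text \<open>Von Dyck's theorem for this presentation. The infinite family of class-2 relators is
  covered by the single hypothesis \<open>nil\<close>, because all words evaluate into
  \<open>H\<close>.\<close>

lemma G_lift:
  assumes "group H" and f: "\<And>x. f x \<in> carrier H"
    and nil: "\<And>a b c. \<lbrakk>a \<in> carrier H; b \<in> carrier H; c \<in> carrier H\<rbrakk>
      \<Longrightarrow> commutator H (commutator H a b) c = \<one>\<^bsub>H\<^esub>"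
    and rels: "f A1 [^]\<^bsub>H\<^esub> p = commutator H (f A1) (f B1)"
      "f A2 [^]\<^bsub>H\<^esub> p = commutator H (f A1) (f B1)"
      "f B1 [^]\<^bsub>H\<^esub> p = commutator H (f A2) (f B1 \<otimes>\<^bsub>H\<^esub> f B2)"
        "f B2 [^]\<^bsub>H\<^esub> p = commutator H (f A2) (f B2)"
      "commutator H (f A1) (f A2) = \<one>\<^bsub>H\<^esub>" "commutator H (f B1) (f B2) = \<one>\<^bsub>H\<^esub>"
  shows "\<exists>h\<in>hom (G p) H. \<forall>x. h (gen p x) = f x"
proof -
  interpret H: group H by fact
  have eval: "word_eval H f u = word_eval H f v" if "(u, v) \<in> G_relations p" for u v
    using that unfolding G_relations_def
    by (elim UnE CollectE exE conjE insertE emptyE)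
      (simp_all only: prod.inject nil rels H.word_eval_comm[OF f] H.word_eval_pow[OF f]
        H.word_eval_letter[OF f] H.word_eval_closed[OF f] H.word_eval_append[OF f] H.word_eval_Nil[OF f])
  from H.presented_group_lift[OF f this] obtain h where
    h: "h \<in> hom (presented_group (G_relations p)) H"
      "\<forall>w. h (pres_class (G_relations p) w) = word_eval H f w" by blast
  then have "h (gen p x) = f x" for x
    by (simp add: gen_def H.word_eval_letter[OF f])
  with h(1) show ?thesis unfolding G_def by blast
qed

lemma G_hom_eqI:
  assumes "group H" "h \<in> hom (G p) H" "k \<in> hom (G p) H" "\<And>x. h (gen p x) = k (gen p x)"
    and "g \<in> carrier (G p)"
  shows "h g = k g"
  using hom_presented_group_eqI[of H h "G_relations p" k g] assms by (simp add: G_def gen_def)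

lemma (in group) word_eval_mem_subgroup:
  assumes "subgroup K G" "\<And>x. f x \<in> K"
  shows "word_eval G f w \<in> K"
proof (induction w)
  case Nil
  then show ?case using subgroup.one_closed[OF assms(1)] by (simp add: word_eval_def)
next
  case (Cons l w)
  obtain x e where "l = (x, e)" by (cases l)
  then show ?case
    using Cons subgroup.m_closed[OF assms(1)] subgroup.m_inv_closed[OF assms(1)] assms(2)
    by (simp add: word_eval_def)
qed

lemma hat_closed: "e \<in> carrier hat"
  by simp

locale G_group = fixes p :: nat
begin

sublocale group "G p" by (rule group_G)

abbreviation gmult (infixl "\<cdot>" 70) where "x \<cdot> y \<equiv> x \<otimes>\<^bsub>G p\<^esub> y"
abbreviation gpow (infixr "\<up>" 75) where "x \<up> i \<equiv> x [^]\<^bsub>G p\<^esub> (i :: int)"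
abbreviation cc where "cc x y \<equiv> commutator (G p) (gen p x) (gen p y)"

lemma gen_closed [simp]: "gen p x \<in> carrier (G p)"
  unfolding gen_def G_def by (rule pres_class_closed)

lemma pres_class_gen: "pres_class (G_relations p) w = word_eval (G p) (gen p) w"
  using pres_class_eval[of "G_relations p" w] unfolding G_def gen_def .

lemma G_relation:
  assumes "(u, v) \<in> G_relations p"
  shows "word_eval (G p) (gen p) u = word_eval (G p) (gen p) v"
  using pres_rel[OF assms] unfolding pres_class_gen[symmetric] pres_class_eq_iff .

lemma gen_relations:
  shows "gen p A1 [^]\<^bsub>G p\<^esub> p = cc A1 B1" "gen p A2 [^]\<^bsub>G p\<^esub> p = cc A1 B1"
    "gen p B1 [^]\<^bsub>G p\<^esub> p = commutator (G p) (gen p A2) (gen p B1 \<cdot> gen p B2)"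
    "gen p B2 [^]\<^bsub>G p\<^esub> p = cc A2 B2"
    "cc A1 A2 = \<one>\<^bsub>G p\<^esub>" "cc B1 B2 = \<one>\<^bsub>G p\<^esub>"
proof -
  note eval = word_eval_comm[OF gen_closed] word_eval_pow[OF gen_closed] word_eval_letter[OF gen_closed]
    word_eval_append[OF gen_closed] word_eval_Nil[OF gen_closed]
  have rel: "(u, v) \<in> G_relations p" if "(u, v) \<in>
    {(word_pow (letter A1) p, word_comm (letter A1) (letter B1)),
     (word_pow (letter A2) p, word_comm (letter A1) (letter B1)),
     (word_pow (letter B1) p, word_comm (letter A2) (letter B1 @ letter B2)),
     (word_pow (letter B2) p, word_comm (letter A2) (letter B2)),
     (word_comm (letter A1) (letter A2), []),
     (word_comm (letter B1) (letter B2), [])}" for u v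
    using that unfolding G_relations_def by blast
  show "gen p A1 [^]\<^bsub>G p\<^esub> p = cc A1 B1"
    using G_relation[OF rel, of "word_pow (letter A1) p" "word_comm (letter A1) (letter B1)"]
    unfolding eval by blast
  show "gen p A2 [^]\<^bsub>G p\<^esub> p = cc A1 B1"
    using G_relation[OF rel, of "word_pow (letter A2) p" "word_comm (letter A1) (letter B1)"]
    unfolding eval by blast
  show "gen p B1 [^]\<^bsub>G p\<^esub> p = commutator (G p) (gen p A2) (gen p B1 \<cdot> gen p B2)"
    using G_relation[OF rel, of "word_pow (letter B1) p"
      "word_comm (letter A2) (letter B1 @ letter B2)"]
    unfolding eval by blast
  show "gen p B2 [^]\<^bsub>G p\<^esub> p = cc A2 B2"
    using G_relation[OF rel, of "word_pow (letter B2) p" "word_comm (letter A2) (letter B2)"]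
    unfolding eval by blast
  show "cc A1 A2 = \<one>\<^bsub>G p\<^esub>"
    using G_relation[OF rel, of "word_comm (letter A1) (letter A2)" "[]"] unfolding eval by blast
  show "cc B1 B2 = \<one>\<^bsub>G p\<^esub>"
    using G_relation[OF rel, of "word_comm (letter B1) (letter B2)" "[]"] unfolding eval by blast
qed

lemma commutator_center:
  assumes "g \<in> carrier (G p)" "h \<in> carrier (G p)"
  shows "commutator (G p) g h \<in> group_center (G p)"
proof (rule group_centerI)
  show c: "commutator (G p) g h \<in> carrier (G p)" using assms by (rule commutator_closed)
  fix k assume k: "k \<in> carrier (G p)"
  have ex: "\<exists>u. g = word_eval (G p) (gen p) u" if "g \<in> carrier (G p)" for g
    using that[unfolded G_def] by (rule presented_groupE) (auto simp: pres_class_gen)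
  obtain u v w where uvw: "g = word_eval (G p) (gen p) u" "h = word_eval (G p) (gen p) v"
    "k = word_eval (G p) (gen p) w" using ex assms k by metis
  have "(word_comm (word_comm u v) w, []) \<in> G_relations p" unfolding G_relations_def by blast
  from G_relation[OF this] have "commutator (G p) (commutator (G p) g h) k = \<one>\<^bsub>G p\<^esub>"
    unfolding uvw word_eval_comm[OF gen_closed] word_eval_Nil[OF gen_closed] .
  then show "commutator (G p) g h \<cdot> k = k \<cdot> commutator (G p) g h"
    using commutator_eq_one_iff[OF c k] by blast
qed

lemma center_pow: "z \<in> group_center (G p) \<Longrightarrow> z \<up> i \<in> group_center (G p)"
  by (rule subgroup_int_pow_closed[OF subgroup_group_center])

lemma center_mult:
  "\<lbrakk>z \<in> group_center (G p); w \<in> group_center (G p)\<rbrakk> \<Longrightarrow> z \<cdot> w \<in> group_center (G p)"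
  by (rule subgroup.m_closed[OF subgroup_group_center])

lemma cc_center: "cc x y \<in> group_center (G p)"
  by (rule commutator_center[OF gen_closed gen_closed])

lemma cc_pow_center: "cc x y \<up> i \<in> group_center (G p)"
  by (rule center_pow[OF cc_center])

lemma cc_closed: "cc x y \<in> carrier (G p)"
  by (rule group_center_closed[OF cc_center])

section \<open>Collecting words into normal form\<close>

lemma center_elem_center: "center_elem p v \<in> group_center (G p)"
  unfolding center_elem_def by (intro center_mult cc_pow_center)

lemma center_elem_closed [simp]: "center_elem p v \<in> carrier (G p)"
  by (rule group_center_closed[OF center_elem_center])

lemma center_elem_add: "center_elem p (v + w) = center_elem p v \<cdot> center_elem p w"
proof -
  have ex: "(a \<cdot> b) \<cdot> (c \<cdot> d) = (a \<cdot> c) \<cdot> (b \<cdot> d)"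
    if "a \<in> group_center (G p)" "b \<in> group_center (G p)" "c \<in> group_center (G p)"
      "d \<in> group_center (G p)"
    for a b c d
    by (rule m_exchange[OF group_center_commutes[OF that(2)]]) (rule group_center_closed, fact)+
  define a b c d where "a = (\<lambda>v::int^4. cc A1 B1 \<up> v $ 1)" and "b = (\<lambda>v::int^4. cc A1 B2 \<up> v $ 2)"
    and "c = (\<lambda>v::int^4. cc A2 B1 \<up> v $ 3)" and "d = (\<lambda>v::int^4. cc A2 B2 \<up> v $ 4)"
  note defs = this
  have cen: "a u \<in> group_center (G p)" "b u \<in> group_center (G p)" "c u \<in> group_center (G p)"
    "d u \<in> group_center (G p)" for u
    by (simp_all only: defs cc_pow_center)
  have elem: "center_elem p u = a u \<cdot> b u \<cdot> c u \<cdot> d u" for u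
    by (simp only: defs center_elem_def)
  have add: "a (v + w) = a v \<cdot> a w" "b (v + w) = b v \<cdot> b w" "c (v + w) = c v \<cdot> c w"
    "d (v + w) = d v \<cdot> d w"
    by (simp_all only: defs vector_add_component int_pow_mult[OF cc_closed])
  show ?thesis
    by (simp only: elem add cen center_mult ex[of "a v \<cdot> b v \<cdot> c v" "d v" "a w \<cdot> b w \<cdot> c w" "d w"]
        ex[of "a v \<cdot> b v" "c v" "a w \<cdot> b w" "c w"] ex[of "a v" "b v" "a w" "b w"])
qed

lemma gen_swap: "gen p x \<cdot> gen p y = gen p y \<cdot> gen p x \<cdot> cc x y"
  using commutator_eq_iff[OF gen_closed gen_closed cc_closed] by blast

lemma gen_pow_swap:
  "gen p y \<up> t \<cdot> gen p x \<up> s = gen p x \<up> s \<cdot> gen p y \<up> t \<cdot> cc x y \<up> (- (s * t))"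
  by (rule int_pow_swap[OF gen_closed gen_closed cc_center gen_swap])

lemma gen_pow_commute:
  assumes "cc x y = \<one>\<^bsub>G p\<^esub>"
  shows "gen p y \<up> t \<cdot> gen p x \<up> s = gen p x \<up> s \<cdot> gen p y \<up> t"
  using gen_pow_swap[of y t x s] unfolding assms by simp

text \<open>The normal form is split because \<open>[a1, a2] = [b1, b2] = 1\<close> makes each half
  additive in the exponents; all non-commutativity then sits in moving \<open>nfB\<close> past
  \<open>nfA\<close>.\<close>

definition nfA where "nfA x = gen p A1 \<up> (x $ 1) \<cdot> gen p A2 \<up> (x $ 2)" for x :: "int ^ 4"
definition nfB where "nfB x = gen p B1 \<up> (x $ 3) \<cdot> gen p B2 \<up> (x $ 4)" for x :: "int ^ 4"

definition nf :: "(int ^ 4) \<times> (int ^ 4) \<Rightarrow> G_elem" where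
  "nf e = nfA (fst e) \<cdot> nfB (fst e) \<cdot> center_elem p (snd e)"

lemma nfA_closed [simp]: "nfA x \<in> carrier (G p)" and nfB_closed [simp]: "nfB x \<in> carrier (G p)"
  by (simp_all add: nfA_def nfB_def)

lemma nf_closed [simp]: "nf e \<in> carrier (G p)"
  by (simp add: nf_def)

lemma nfA_add: "nfA (x + y) = nfA x \<cdot> nfA y"
  unfolding nfA_def vector_add_component int_pow_mult[OF gen_closed]
  by (rule m_exchange) (simp_all add: gen_pow_commute[OF gen_relations(5)])

lemma nfB_add: "nfB (x + y) = nfB x \<cdot> nfB y"
  unfolding nfB_def vector_add_component int_pow_mult[OF gen_closed]
  by (rule m_exchange) (simp_all add: gen_pow_commute[OF gen_relations(6)])

text \<open>Each of the four pairs of an \<open>a\<close>-power and a \<open>b\<close>-power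
  contributes one power of a basis commutator, and together these form the cocycle
  \<open>bil\<close>.\<close>

lemma nfB_nfA: "nfB x \<cdot> nfA y = nfA y \<cdot> nfB x \<cdot> center_elem p (bil x y)"
proof -
  let ?c = "\<lambda>a b i j. cc a b \<up> (- (y $ i * x $ j))"
  note closed = int_pow_closed[OF gen_closed]
  have row: "gen p b \<up> (x $ j) \<cdot> nfA y = nfA y \<cdot> gen p b \<up> (x $ j) \<cdot> (?c A1 b 1 j \<cdot> ?c A2 b 2 j)" for b j
    unfolding nfA_def
    by (rule swap_mult_right[OF gen_pow_swap gen_pow_swap closed closed closed cc_pow_center cc_pow_center])
  have "nfB x \<cdot> nfA y = nfA y \<cdot> nfB x \<cdot>
      ((?c A1 B1 1 3 \<cdot> ?c A2 B1 2 3) \<cdot> (?c A1 B2 1 4 \<cdot> ?c A2 B2 2 4))"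
    unfolding nfB_def
    by (rule swap_mult_left[OF row row closed closed nfA_closed center_mult center_mult])
      (rule cc_pow_center)+
  also have "(?c A1 B1 1 3 \<cdot> ?c A2 B1 2 3) \<cdot> (?c A1 B2 1 4 \<cdot> ?c A2 B2 2 4) =
      (?c A1 B1 1 3 \<cdot> ?c A1 B2 1 4) \<cdot> (?c A2 B1 2 3 \<cdot> ?c A2 B2 2 4)"
    by (rule m_exchange) (intro group_center_commutes[OF cc_pow_center] group_center_closed[OF cc_pow_center])+
  also have "\<dots> = center_elem p (bil x y)"
    unfolding center_elem_def bil_def vec4_nth
    by (simp add: m_assoc cc_closed)
  finally show ?thesis .
qed

text \<open>Only class 2 and the two trivial commutators enter here, not the power relations, which
  is why the source is the integral group.\<close>

lemma nf_hom: "nf \<in> hom hat (G p)"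
proof (rule homI)
  fix e e' :: "(int ^ 4) \<times> (int ^ 4)"
  obtain x z where e: "e = (x, z)" by (cases e)
  obtain y w where e': "e' = (y, w)" by (cases e')
  have "nf e \<cdot> nf e' = (nfA x \<cdot> nfB x) \<cdot> (nfA y \<cdot> nfB y) \<cdot> (center_elem p z \<cdot> center_elem p w)"
    unfolding nf_def e e' fst_conv snd_conv
    by (rule m_exchange[OF group_center_commutes[OF center_elem_center]]) simp_all
  also have "(nfA x \<cdot> nfB x) \<cdot> (nfA y \<cdot> nfB y) = nfA x \<cdot> (nfB x \<cdot> nfA y) \<cdot> nfB y"
    by (simp add: m_assoc)
  also have "\<dots> = nfA x \<cdot> nfA y \<cdot> nfB x \<cdot> (center_elem p (bil x y) \<cdot> nfB y)"
    unfolding nfB_nfA by (simp add: m_assoc)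
  also have "center_elem p (bil x y) \<cdot> nfB y = nfB y \<cdot> center_elem p (bil x y)"
    by (rule group_center_commutes[OF center_elem_center nfB_closed])
  also have "nfA x \<cdot> nfA y \<cdot> nfB x \<cdot> (nfB y \<cdot> center_elem p (bil x y)) \<cdot> (center_elem p z \<cdot> center_elem p w)
     = (nfA x \<cdot> nfA y) \<cdot> (nfB x \<cdot> nfB y) \<cdot> (center_elem p (bil x y) \<cdot> (center_elem p z \<cdot> center_elem p w))"
    by (simp add: m_assoc)
  also have "\<dots> = nfA (x + y) \<cdot> nfB (x + y) \<cdot> center_elem p (bil x y + (z + w))"
    by (simp only: nfA_add nfB_add center_elem_add)
  also have "\<dots> = nf (e \<otimes>\<^bsub>hat\<^esub> e')"
    unfolding e e' mult_hat nf_def fst_conv snd_conv by (simp add: add.commute add.left_commute)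
  finally show "nf (e \<otimes>\<^bsub>hat\<^esub> e') = nf e \<cdot> nf e'" by simp
qed simp

sublocale nf: group_hom hat "G p" nf
  by (rule group_hom.intro) (simp_all add: group_hom_axioms_def hat.is_group group_G nf_hom)

lemma center_elem_0 [simp]: "center_elem p 0 = \<one>\<^bsub>G p\<^esub>"
  by (simp add: center_elem_def)

lemma nf_central: "nf (0, z) = center_elem p z"
  by (simp add: nf_def nfA_def nfB_def)

lemma nf_gen: "nf (hat_gen x) = gen p x"
  by (cases x) (simp_all add: nf_def nfA_def nfB_def hat_gen_def)

lemma nf_surj:
  assumes "g \<in> carrier (G p)"
  obtains e where "g = nf e"
proof -
  obtain w where "g = word_eval (G p) (gen p) w"
    using assms[unfolded G_def] by (rule presented_groupE) (auto simp: pres_class_gen)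
  moreover have "word_eval (G p) (gen p) w \<in> range nf"
    using word_eval_mem_subgroup[OF nf.img_is_subgroup] nf_gen by (metis carrier_hat rangeI)
  ultimately show ?thesis using that by blast
qed

text \<open>Here the power relations enter. This is the easy inclusion: \<open>relN\<close> lies in
  the kernel of \<open>nf\<close>.\<close>

lemma nf_relN:
  assumes "e \<in> relN p"
  shows "nf e = \<one>\<^bsub>G p\<^esub>"
proof -
  obtain t v where e: "e = (int p *s t, int p *s v - powv t)" using assms by (auto simp: relN_def)
  \<comment> \<open>Commutators with \<open>x\<close> have exponent \<open>p\<close> as soon as the
    p-th power of \<open>x\<close> is central.\<close>
  have cc_p: "cc x y \<up> int p = \<one>\<^bsub>G p\<^esub>" if "gen p x \<up> int p \<in> group_center (G p)" for x y
  proof -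
    have "gen p x \<up> int p \<cdot> gen p y = gen p y \<cdot> gen p x \<up> int p \<cdot> cc x y \<up> int p"
      by (rule int_pow_swap_left[OF gen_closed gen_closed cc_center gen_swap])
    then have "gen p y \<cdot> gen p x \<up> int p \<cdot> cc x y \<up> int p = gen p y \<cdot> gen p x \<up> int p"
      using group_center_commutes[OF that gen_closed[of y]] by simp
    then show ?thesis by (simp add: cc_closed r_cancel_one)
  qed
  have pow1: "gen p A1 \<up> int p = center_elem p (vec4 1 0 0 0)"
    using gen_relations(1) by (simp add: int_pow_int center_elem_def cc_closed)
  have pow2: "gen p A2 \<up> int p = center_elem p (vec4 1 0 0 0)"
    using gen_relations(2) by (simp add: int_pow_int center_elem_def cc_closed)
  have pow4: "gen p B2 \<up> int p = center_elem p (vec4 0 0 0 1)"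
    using gen_relations(4) by (simp add: int_pow_int center_elem_def cc_closed)
  \<comment> \<open>The commutator of \<open>a2\<close> with \<open>b1 b2\<close> is expanded by
    computing it in \<open>hat\<close> and applying \<open>nf\<close>.\<close>
  have "commutator (G p) (gen p A2) (gen p B1 \<cdot> gen p B2) =
      nf (commutator hat (hat_gen A2) (hat_gen B1 \<otimes>\<^bsub>hat\<^esub> hat_gen B2))"
    unfolding nf.hom_commutator[OF hat_closed hat_closed]
    by (simp add: nf_gen)
  also have "commutator hat (hat_gen A2) (hat_gen B1 \<otimes>\<^bsub>hat\<^esub> hat_gen B2) = (0, vec4 0 0 1 1)"
    by (simp add: hat_gen_simps vec4_eq_iff bil_def)
  finally have pow3: "gen p B1 \<up> int p = center_elem p (vec4 0 0 1 1)"
    using gen_relations(3) by (simp add: int_pow_int nf_central)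
  have c1: "center_elem p (int p *s v) = \<one>\<^bsub>G p\<^esub>"
  proof -
    have "cc x y \<up> (int p * i) = \<one>\<^bsub>G p\<^esub>" if "x \<in> {A1, A2}" for x y i
    proof -
      have "gen p x \<up> int p \<in> group_center (G p)" using that pow1 pow2 center_elem_center by auto
      from cc_p[OF this, of y] have "(cc x y \<up> int p) \<up> i = \<one>\<^bsub>G p\<^esub>" by simp
      then show ?thesis by (simp add: int_pow_pow[OF cc_closed])
    qed
    then show ?thesis by (simp add: center_elem_def)
  qed
  have pow: "gen p x \<up> (int p * i) = nf (0, i *s u)" if "gen p x \<up> int p = center_elem p u" for x i u
  proof -
    have "gen p x \<up> (int p * i) = (gen p x \<up> int p) \<up> i" by (simp add: int_pow_pow)
    also have "\<dots> = nf ((0, u) [^]\<^bsub>hat\<^esub> i)"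
      unfolding that by (simp only: nf.hom_int_pow[OF hat_closed] nf_central)
    finally show ?thesis by (simp add: int_pow_hat)
  qed
  have "nf (int p *s t, 0) = nf (0, powv t)"
  proof -
    have "nf (int p *s t, 0) = nf (0, (t $ 1) *s vec4 1 0 0 0) \<cdot> nf (0, (t $ 2) *s vec4 1 0 0 0) \<cdot>
      (nf (0, (t $ 3) *s vec4 0 0 1 1) \<cdot> nf (0, (t $ 4) *s vec4 0 0 0 1))"
      by (simp add: nf_def[of "(int p *s t, 0)"] nfA_def nfB_def pow[OF pow1] pow[OF pow2]
        pow[OF pow3] pow[OF pow4])
    also have "\<dots> = nf ((0, (t $ 1) *s vec4 1 0 0 0) \<otimes>\<^bsub>hat\<^esub> (0, (t $ 2) *s vec4 1 0 0 0) \<otimes>\<^bsub>hat\<^esub>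
      ((0, (t $ 3) *s vec4 0 0 1 1) \<otimes>\<^bsub>hat\<^esub> (0, (t $ 4) *s vec4 0 0 0 1)))"
      by (simp only: nf.hom_mult[OF hat_closed hat_closed])
    also have "(0, (t $ 1) *s vec4 1 0 0 0) \<otimes>\<^bsub>hat\<^esub> (0, (t $ 2) *s vec4 1 0 0 0) \<otimes>\<^bsub>hat\<^esub>
      ((0, (t $ 3) *s vec4 0 0 1 1) \<otimes>\<^bsub>hat\<^esub> (0, (t $ 4) *s vec4 0 0 0 1)) = (0, powv t)"
      by (simp add: powv_def vec4_eq_iff)
    finally show ?thesis .
  qed
  then have "nf ((int p *s t, 0) \<otimes>\<^bsub>hat\<^esub> (0, - powv t) \<otimes>\<^bsub>hat\<^esub> (0, int p *s v)) =
      nf ((0, powv t) \<otimes>\<^bsub>hat\<^esub> (0, - powv t)) \<cdot> \<one>\<^bsub>G p\<^esub>"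
    by (simp only: nf.hom_mult[OF hat_closed hat_closed] nf_central[of "int p *s v"] c1)
  then show ?thesis unfolding e by (simp add: nf_central)
qed

text \<open>This bounds \<open>G\<close> from below. The quotient of \<open>hat\<close> satisfies
  the relations, so \<open>G\<close> maps onto it, and the composite with \<open>nf\<close> is the
  canonical projection; hence the kernel of \<open>nf\<close> is no larger than
  \<open>relN\<close>.\<close>

lemma hom_coset:
  obtains h where "h \<in> hom (G p) (hat Mod relN p)" "\<And>e. h (nf e) = relN p #>\<^bsub>hat\<^esub> e"
proof -
  interpret N: normal "relN p" hat by (rule normal_relN)
  let ?K = "hat Mod relN p" and ?\<pi> = "\<lambda>e. relN p #>\<^bsub>hat\<^esub> e"
  have K: "group ?K" by (rule N.factorgroup_is_group)
  interpret pi: group_hom hat ?K ?\<pi>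
    by (rule group_hom.intro) (simp_all add: group_hom_axioms_def hat.is_group K N.r_coset_hom_Mod)
  note U = hat_closed
  have carrierE: "\<exists>e. a = ?\<pi> e" if "a \<in> carrier ?K" for a
    using that by (auto simp: FactGroup_def RCOSETS_def)
  have "\<exists>h\<in>hom (G p) ?K. \<forall>x. h (gen p x) = ?\<pi> (hat_gen x)"
  proof (rule G_lift[OF K])
    show "?\<pi> (hat_gen x) \<in> carrier ?K" for x by (rule pi.hom_closed[OF U])
    fix a b c assume "a \<in> carrier ?K" "b \<in> carrier ?K" "c \<in> carrier ?K"
    then obtain e e' e'' where abc: "a = ?\<pi> e" "b = ?\<pi> e'" "c = ?\<pi> e''" using carrierE by metis
    have "commutator hat (commutator hat e e') e'' = \<one>\<^bsub>hat\<^esub>"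
      by (cases e; cases e'; cases e'') simp
    then show "commutator ?K (commutator ?K a b) c = \<one>\<^bsub>?K\<^esub>"
      unfolding abc pi.hom_commutator[OF U U, symmetric] pi.hom_one[symmetric] by (rule arg_cong)
  next
    note push = pi.hom_nat_pow[OF U, symmetric] pi.hom_commutator[OF U U, symmetric]
      pi.hom_mult[OF U U, symmetric] pi.hom_one[symmetric]
    \<comment> \<open>Modulo \<open>relN\<close> the p-th power of a generator is
      \<open>(0, powv t)\<close> with \<open>t\<close> its unit vector, whence the first witness.
      The two commutation relations hold exactly in \<open>hat\<close>, with
      \<open>t = 0\<close>.\<close>
    note eval = hat_gen_simps nat_pow_hat commutator_hat mult_hat one_hat relN_coset_eq_iff
    show "?\<pi> (hat_gen A1) [^]\<^bsub>?K\<^esub> p = commutator ?K (?\<pi> (hat_gen A1)) (?\<pi> (hat_gen B1))"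
      unfolding push eval
      by (intro exI[of _ "vec4 1 0 0 0"] exI[of _ 0]) (simp add: vec4_eq_iff bil_def powv_def)
    show "?\<pi> (hat_gen A2) [^]\<^bsub>?K\<^esub> p = commutator ?K (?\<pi> (hat_gen A1)) (?\<pi> (hat_gen B1))"
      unfolding push eval
      by (intro exI[of _ "vec4 0 1 0 0"] exI[of _ 0]) (simp add: vec4_eq_iff bil_def powv_def)
    show "?\<pi> (hat_gen B1) [^]\<^bsub>?K\<^esub> p =
        commutator ?K (?\<pi> (hat_gen A2)) (?\<pi> (hat_gen B1) \<otimes>\<^bsub>?K\<^esub> ?\<pi> (hat_gen B2))"
      unfolding push eval
      by (intro exI[of _ "vec4 0 0 1 0"] exI[of _ 0]) (simp add: vec4_eq_iff bil_def powv_def)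
    show "?\<pi> (hat_gen B2) [^]\<^bsub>?K\<^esub> p = commutator ?K (?\<pi> (hat_gen A2)) (?\<pi> (hat_gen B2))"
      unfolding push eval
      by (intro exI[of _ "vec4 0 0 0 1"] exI[of _ 0]) (simp add: vec4_eq_iff bil_def powv_def)
    show "commutator ?K (?\<pi> (hat_gen A1)) (?\<pi> (hat_gen A2)) = \<one>\<^bsub>?K\<^esub>"
      unfolding push eval
      by (intro exI[of _ 0] exI[of _ 0]) (simp add: vec4_eq_iff bil_def powv_def)
    show "commutator ?K (?\<pi> (hat_gen B1)) (?\<pi> (hat_gen B2)) = \<one>\<^bsub>?K\<^esub>"
      unfolding push eval
      by (intro exI[of _ 0] exI[of _ 0]) (simp add: vec4_eq_iff bil_def powv_def)
  qed
  then obtain h where h: "h \<in> hom (G p) ?K" "\<And>x. h (gen p x) = ?\<pi> (hat_gen x)" by blast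
  interpret h: group_hom "G p" ?K h
    by (rule group_hom.intro) (simp_all add: group_hom_axioms_def group_G K h)
  have "h (nf e) = ?\<pi> e" for e
  proof -
    obtain x z where e: "e = (x, z)" by (cases e)
    have "h (nf e) = ?\<pi> ((hat_gen A1 [^]\<^bsub>hat\<^esub> (x $ 1) \<otimes>\<^bsub>hat\<^esub> hat_gen A2 [^]\<^bsub>hat\<^esub> (x $ 2)) \<otimes>\<^bsub>hat\<^esub>
    (hat_gen B1 [^]\<^bsub>hat\<^esub> (x $ 3) \<otimes>\<^bsub>hat\<^esub> hat_gen B2 [^]\<^bsub>hat\<^esub> (x $ 4)) \<otimes>\<^bsub>hat\<^esub>
    (commutator hat (hat_gen A1) (hat_gen B1) [^]\<^bsub>hat\<^esub> (z $ 1) \<otimes>\<^bsub>hat\<^esub>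
     commutator hat (hat_gen A1) (hat_gen B2) [^]\<^bsub>hat\<^esub> (z $ 2) \<otimes>\<^bsub>hat\<^esub>
     commutator hat (hat_gen A2) (hat_gen B1) [^]\<^bsub>hat\<^esub> (z $ 3) \<otimes>\<^bsub>hat\<^esub>
     commutator hat (hat_gen A2) (hat_gen B2) [^]\<^bsub>hat\<^esub> (z $ 4)))"
      unfolding e nf_def nfA_def nfB_def center_elem_def fst_conv snd_conv
        pi.hom_mult[OF U U] pi.hom_int_pow[OF U] pi.hom_commutator[OF U U]
      by (simp only: h.hom_mult h.hom_int_pow h.hom_commutator h(2) m_closed int_pow_closed
          gen_closed cc_closed)
    then show ?thesis unfolding hat_normal_form[symmetric] e .
  qed
  with h(1) show ?thesis by (rule that)
qed

text \<open>The two bounds combined: equality in \<open>G\<close> becomes a condition on integer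
  vectors, through which all later comparisons of elements pass.\<close>

lemma nf_eq_iff:
  "nf (x, z) = nf (y, w) \<longleftrightarrow> (\<exists>t v. x = y + int p *s t \<and> z = w - powv t + int p *s v)"
proof -
  interpret N: normal "relN p" hat by (rule normal_relN)
  obtain h where h: "\<And>e. h (nf e) = relN p #>\<^bsub>hat\<^esub> e" using hom_coset by blast
  have "relN p #>\<^bsub>hat\<^esub> (x, z) = relN p #>\<^bsub>hat\<^esub> (y, w)" if "nf (x, z) = nf (y, w)"
    using that h by metis
  moreover have "nf (x, z) = nf (y, w)" if "relN p #>\<^bsub>hat\<^esub> (x, z) = relN p #>\<^bsub>hat\<^esub> (y, w)"
  proof -
    have "(x, z) \<in> relN p #>\<^bsub>hat\<^esub> (y, w)"
      using hat.rcos_self[OF _ N.subgroup_axioms, of "(x, z)"] that by simp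
    then obtain n where "n \<in> relN p" "(x, z) = n \<otimes>\<^bsub>hat\<^esub> (y, w)" by (auto simp: r_coset_def)
    then show ?thesis by (simp add: nf_relN)
  qed
  ultimately show ?thesis unfolding relN_coset_eq_iff[symmetric] by blast
qed

end

lemma residue_ring_ops:
  assumes "1 < p"
  shows "carrier (Fp p) = {0..<int p}" "\<zero>\<^bsub>Fp p\<^esub> = 0"
    "a \<oplus>\<^bsub>Fp p\<^esub> b = (a + b) mod int p" "a \<otimes>\<^bsub>Fp p\<^esub> b = (a * b) mod int p"
    "\<lbrakk>a \<in> carrier (Fp p); b \<in> carrier (Fp p)\<rbrakk> \<Longrightarrow> a \<ominus>\<^bsub>Fp p\<^esub> b = (a - b) mod int p"
proof -
  interpret residues "int p" "Fp p" using assms by unfold_locales auto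
  show "carrier (Fp p) = {0..<int p}" "\<zero>\<^bsub>Fp p\<^esub> = 0"
    "a \<oplus>\<^bsub>Fp p\<^esub> b = (a + b) mod int p" "a \<otimes>\<^bsub>Fp p\<^esub> b = (a * b) mod int p"
    by (auto simp: residue_ring_def)
  show "a \<ominus>\<^bsub>Fp p\<^esub> b = (a - b) mod int p" if "a \<in> carrier (Fp p)" "b \<in> carrier (Fp p)"
    using that by (simp add: a_minus_def res_neg_eq res_add_eq mod_add_right_eq)
qed

lemma vecs_iff: "1 < p \<Longrightarrow> x \<in> vecs p \<longleftrightarrow> (\<forall>j. 0 \<le> x $ j \<and> x $ j < int p)"
  by (simp add: vecs_def residue_ring_ops)

context G_group
begin

subsection \<open>Congruences between normal forms\<close>

lemma nf_mult: "nf (x, z) \<cdot> nf (y, w) = nf (x + y, z + w + bil x y)"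
  using nf.hom_mult[OF hat_closed hat_closed, of "(x, z)" "(y, w)"] by simp

lemma nf_inv: "inv\<^bsub>G p\<^esub> nf (x, z) = nf (- x, bil x x - z)"
  using nf.hom_inv[OF hat_closed, of "(x, z)"] by simp

lemma nf_commutator: "commutator (G p) (nf (x, z)) (nf (y, w)) = nf (0, bil x y - bil y x)"
  using nf.hom_commutator[OF hat_closed hat_closed, of "(x, z)" "(y, w)"] by simp

lemma nf_int_pow: "bil x x = 0 \<Longrightarrow> nf (x, z) \<up> i = nf (i *s x, i *s z)"
  using nf.hom_int_pow[OF hat_closed, of "(x, z)" i] by (simp add: int_pow_hat)

lemma nf_0: "nf (0, 0) = \<one>\<^bsub>G p\<^esub>"
  by (simp add: nf_central)

lemma nf_add_multiple: "nf (y + int p *s t, w) = nf (y, w + powv t)"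
  unfolding nf_eq_iff by (intro exI[of _ t] exI[of _ 0]) (simp add: vec4_eq_iff)

lemma nf_cong_fst:
  assumes "\<And>i. int p dvd (x - y) $ i"
  obtains w where "nf (x, z) = nf (y, w)"
proof -
  have "x = y + int p *s (\<chi> i. (x - y) $ i div int p)"
    using assms by (simp add: vec_eq_iff)
  then show ?thesis using that nf_add_multiple by metis
qed

lemma nf_cong_snd:
  assumes "\<And>i. int p dvd (z - w) $ i"
  shows "nf (x, z) = nf (x, w)"
  unfolding nf_eq_iff
proof (intro exI conjI)
  show "x = x + int p *s 0" by simp
  show "z = w - powv 0 + int p *s (\<chi> i. (z - w) $ i div int p)"
    using assms by (simp add: vec_eq_iff forall_4 powv_def)
qed

text \<open>The binomial term is the source of the quadratic terms in
  \<open>endo_classification\<close>. The central part \<open>z\<close> leaves no trace, since the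
  center has exponent \<open>p\<close>.\<close>

lemma nf_pow_p: "nf (x, z) [^]\<^bsub>G p\<^esub> p = nf (0, powv x + int (p choose 2) *s bil x x)"
proof -
  have "nf (x, z) [^]\<^bsub>G p\<^esub> p = nf (0 + int p *s x, int p *s z + int (p choose 2) *s bil x x)"
    using nf.hom_nat_pow[OF hat_closed, of "(x, z)" p] by (simp add: nat_pow_hat)
  also have "\<dots> = nf (0, int p *s z + int (p choose 2) *s bil x x + powv x)"
    by (rule nf_add_multiple)
  also have "\<dots> = nf (0, powv x + int (p choose 2) *s bil x x)"
    by (rule nf_cong_snd) simp
  finally show ?thesis .
qed

text \<open>With equal first components and \<open>p > 0\<close> the parameter \<open>t\<close> is
  zero, so no power is carried into the center.\<close>

lemma nf_snd_eqD:
  assumes "p > 0" "nf (x, z) = nf (x, w)"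
  shows "int p dvd (z - w) $ i"
proof -
  obtain t v where t: "x = x + int p *s t" "z = w - powv t + int p *s v"
    using assms(2) unfolding nf_eq_iff by blast
  have "t = 0" using t(1) assms(1) by (simp add: vec_eq_iff)
  then have "z = w + int p *s v" using t(2) by (simp add: powv_def vec4_eq_iff)
  then show ?thesis by simp
qed

lemma nf_fst_eqD: "nf (x, z) = nf (y, w) \<Longrightarrow> int p dvd (x - y) $ i"
  unfolding nf_eq_iff by auto

end

subsection \<open>Endomorphisms in coordinates\<close>

definition ix :: "generator \<Rightarrow> 4" where
  "ix x = (case x of A1 \<Rightarrow> 1 | A2 \<Rightarrow> 2 | B1 \<Rightarrow> 3 | B2 \<Rightarrow> 4)"

definition gx :: "4 \<Rightarrow> generator" where
  "gx j = (if j = 1 then A1 else if j = 2 then A2 else if j = 3 then B1 else B2)"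

lemma gx_ix: "gx (ix x) = x"
  by (cases x) (simp_all add: gx_def ix_def)

lemma ix_gx: "ix (gx j) = j"
  using exhaust_4[of j] by (auto simp: gx_def ix_def)

text \<open>The exponent vector of \<open>a1 a2^-1\<close>. It spans the kernel of
  \<open>powv\<close>, the reason why the p-th power of \<open>a1 a2^-1\<close> is trivial.\<close>

definition kv :: "int ^ 4" where "kv = vec4 1 (- 1) 0 0"

lemma kv_nth [simp]: "kv $ 1 = 1" "kv $ 2 = - 1" "kv $ 3 = 0" "kv $ 4 = 0"
  by (simp_all add: kv_def)

text \<open>The exponent vectors of the images of the generators under the normalized endomorphism
  encoded by \<open>s\<close>.\<close>

definition base :: "(int ^ 4) option \<Rightarrow> generator \<Rightarrow> int ^ 4" where
  "base s x = (case s of None \<Rightarrow> fst (hat_gen x) | Some v \<Rightarrow> v $ ix x *s kv)"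

locale G_prime = G_group +
  assumes prime: "prime p"
begin

lemma p_gt_1: "1 < p" and p_pos: "0 < p"
  using prime prime_gt_1_nat prime_gt_0_nat by auto

text \<open>The graph of \<open>alpha\<close>, but without definite descriptions. Existence and
  uniqueness on both sides give the bijection, and \<open>alpha_realizes\<close> identifies the
  two.\<close>

definition realizes :: "(G_elem \<Rightarrow> G_elem) \<Rightarrow> int ^ 4 ^ 4 \<Rightarrow> (int ^ 4) option \<Rightarrow> bool" where
  "realizes \<phi> M s \<longleftrightarrow> \<phi> \<in> carrier (End (G p)) \<and> M \<in> carrier (Mat p) \<and> s \<in> carrier (S1 p) \<and>
    (\<forall>x. \<phi> (gen p x) = nf (base s x, column (ix x) M))"

lemma Mat_iff: "M \<in> carrier (Mat p) \<longleftrightarrow> (\<forall>i j. 0 \<le> M $ i $ j \<and> M $ i $ j < int p)"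
  by (simp add: Mat_def residue_ring_ops[OF p_gt_1])

lemma S1_iff: "s \<in> carrier (S1 p) \<longleftrightarrow> (\<forall>v. s = Some v \<longrightarrow> v \<in> vecs p)"
  by (cases s) (auto simp: S1_def adjoin_one_def)

lemma End_iff: "\<phi> \<in> carrier (End (G p)) \<longleftrightarrow> \<phi> \<in> hom (G p) (G p) \<and> \<phi> \<in> extensional (carrier (G p))"
  by (simp add: End_def)

lemma End_group_hom: "\<phi> \<in> carrier (End (G p)) \<Longrightarrow> group_hom (G p) (G p) \<phi>"
  by (simp add: End_iff group_hom_def group_hom_axioms_def group_G)

lemma End_eqI:
  assumes "\<phi> \<in> carrier (End (G p))" "\<phi>' \<in> carrier (End (G p))" "\<And>x. \<phi> (gen p x) = \<phi>' (gen p x)"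
  shows "\<phi> = \<phi>'"
proof (rule extensionalityI)
  show "\<phi> \<in> extensional (carrier (G p))" "\<phi>' \<in> extensional (carrier (G p))"
    using assms(1,2) by (simp_all add: End_iff)
  have "\<phi> \<in> hom (G p) (G p)" "\<phi>' \<in> hom (G p) (G p)"
    using assms(1,2) by (simp_all add: End_iff)
  from G_hom_eqI[OF group_G this assms(3)]
  show "\<phi> g = \<phi>' g" if "g \<in> carrier (G p)" for g using that .
qed

lemma residue_eq:
  assumes "int p dvd a - b" "0 \<le> a" "a < int p" "0 \<le> b" "b < int p"
  shows "a = b"
  using assms by (metis mod_eq_dvd_iff mod_pos_pos_trivial)

lemma bil_kv [simp]: "bil (n *s kv) (m *s kv) = 0"
  by (simp add: bil_def vec4_eq_iff)

lemma bil_kv_self [simp]: "bil kv kv = 0"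
  by (simp add: bil_def vec4_eq_iff)

lemma bil_hat_gen [simp]: "bil (fst (hat_gen x)) (fst (hat_gen x)) = 0"
  by (cases x) (simp_all add: hat_gen_def bil_def vec4_eq_iff)

lemma bil_base [simp]: "bil (base s x) (base s x) = 0"
  by (cases s) (simp_all add: base_def)

lemma powv_kv [simp]: "powv (n *s kv) = 0"
  by (simp add: powv_def vec4_eq_iff)

text \<open>Because \<open>powv\<close> vanishes on \<open>kv\<close>, reducing the coefficient
  modulo \<open>p\<close> does not disturb the central part.\<close>

lemma nf_kv_cong:
  assumes "int p dvd n - m" "\<And>i. int p dvd (z - w) $ i"
  shows "nf (n *s kv, z) = nf (m *s kv, w)"
proof -
  obtain k where "n = m + int p * k" using assms(1) by (metis dvdE diff_add_cancel add.commute)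
  then have "n *s kv = m *s kv + int p *s (k *s kv)" by (simp add: vec_eq_iff algebra_simps)
  then have "nf (n *s kv, z) = nf (m *s kv, z)"
    by (simp only: nf_add_multiple powv_kv add_0_right)
  also have "\<dots> = nf (m *s kv, w)" by (rule nf_cong_snd[OF assms(2)])
  finally show ?thesis .
qed

lemma realizes_unique:
  assumes "realizes \<phi> M s" "realizes \<phi> M' s'"
  shows "M = M'" "s = s'"
proof -
  have eq: "nf (base s x, column (ix x) M) = nf (base s' x, column (ix x) M')" for x
    using assms unfolding realizes_def by metis
  have dvd: "int p dvd (base s x - base s' x) $ i" for x i by (rule nf_fst_eqD[OF eq])
  have one: "\<not> int p dvd 1" "\<not> int p dvd - 1" using p_gt_1 by simp_all
  have vecs: "0 \<le> v $ j" "v $ j < int p" if "s = Some v \<or> s' = Some v" for v j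
    using that assms unfolding realizes_def S1_iff vecs_iff[OF p_gt_1] by blast+
  show s: "s = s'"
  proof (cases s; cases s')
    \<comment> \<open>The \<open>b1\<close>-exponent of the image of \<open>b1\<close> is 1 for the
      identity and 0 for every vector.\<close>
    fix v assume "s = None" "s' = Some v"
    then show ?thesis using dvd[of B1 3] one by (simp add: base_def hat_gen_def)
  next
    fix v assume "s = Some v" "s' = None"
    then show ?thesis using dvd[of B1 3] one by (simp add: base_def hat_gen_def)
  next
    fix v v' assume sv: "s = Some v" "s' = Some v'"
    have "v $ ix x = v' $ ix x" for x
      by (rule residue_eq) (use dvd[of x 1] sv vecs in \<open>simp_all add: base_def\<close>)
    then have "v $ j = v' $ j" for j using ix_gx by metis
    then have "v = v'" by (simp add: vec_eq_iff)
    then show ?thesis using sv by simp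
  qed simp
  have "M $ i $ ix x = M' $ i $ ix x" for i x
  proof (rule residue_eq)
    show "int p dvd M $ i $ ix x - M' $ i $ ix x"
      using nf_snd_eqD[OF p_pos eq[of x, unfolded s], of i] by (simp add: column_def)
  qed (use assms in \<open>simp_all add: realizes_def Mat_iff\<close>)
  then have "M $ i $ j = M' $ i $ j" for i j using ix_gx by metis
  then show "M = M'" by (simp add: vec_eq_iff)
qed

lemma realizes_eq: "\<lbrakk>realizes \<phi> M s; realizes \<phi>' M s\<rbrakk> \<Longrightarrow> \<phi> = \<phi>'"
  by (rule End_eqI) (simp_all add: realizes_def)

text \<open>The central parts of the images may be arbitrary: commutators do not see them, and p-th
  powers kill them.\<close>

lemma realizes_exists:
  assumes "M \<in> carrier (Mat p)" "s \<in> carrier (S1 p)"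
  obtains \<phi> where "realizes \<phi> M s"
proof -
  let ?f = "\<lambda>x. nf (base s x, column (ix x) M)"
  have "\<exists>h\<in>hom (G p) (G p). \<forall>x. h (gen p x) = ?f x"
  proof (rule G_lift[OF group_G nf_closed])
    fix a b c assume abc: "a \<in> carrier (G p)" "b \<in> carrier (G p)" "c \<in> carrier (G p)"
    show "commutator (G p) (commutator (G p) a b) c = \<one>\<^bsub>G p\<^esub>"
      using commutator_eq_one_iff[OF commutator_closed[OF abc(1,2)] abc(3)]
        group_center_commutes[OF commutator_center[OF abc(1,2)] abc(3)] by blast
  next
    note simps = base_def hat_gen_def vec4_eq_iff powv_def bil_def
    \<comment> \<open>These hold over the integers, not just modulo \<open>p\<close>. For
      \<open>Some v\<close> both sides vanish, since multiples of \<open>kv\<close> commute and have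
      trivial power.\<close>
    have rels: "powv (base s A1) = bil (base s A1) (base s B1) - bil (base s B1) (base s A1)"
      "powv (base s A2) = bil (base s A1) (base s B1) - bil (base s B1) (base s A1)"
      "powv (base s B1) = bil (base s A2) (base s B1 + base s B2) - bil (base s B1 + base s B2) (base s A2)"
      "powv (base s B2) = bil (base s A2) (base s B2) - bil (base s B2) (base s A2)"
      "bil (base s A1) (base s A2) - bil (base s A2) (base s A1) = 0"
      "bil (base s B1) (base s B2) - bil (base s B2) (base s B1) = 0"
      by (cases s; simp add: simps)+
    have pow: "?f x [^]\<^bsub>G p\<^esub> p = nf (0, powv (base s x))" for x
      unfolding nf_pow_p by (simp add: vector_smult_rzero)
    show "?f A1 [^]\<^bsub>G p\<^esub> p = commutator (G p) (?f A1) (?f B1)"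
      unfolding pow nf_commutator rels(1) ..
    show "?f A2 [^]\<^bsub>G p\<^esub> p = commutator (G p) (?f A1) (?f B1)"
      unfolding pow nf_commutator rels(2) ..
    show "?f B1 [^]\<^bsub>G p\<^esub> p = commutator (G p) (?f A2) (?f B1 \<cdot> ?f B2)"
      unfolding pow nf_mult nf_commutator rels(3) ..
    show "?f B2 [^]\<^bsub>G p\<^esub> p = commutator (G p) (?f A2) (?f B2)"
      unfolding pow nf_commutator rels(4) ..
    show "commutator (G p) (?f A1) (?f A2) = \<one>\<^bsub>G p\<^esub>"
      unfolding nf_commutator rels(5) nf_0 ..
    show "commutator (G p) (?f B1) (?f B2) = \<one>\<^bsub>G p\<^esub>"
      unfolding nf_commutator rels(6) nf_0 ..
  qed
  then obtain h where h: "h \<in> hom (G p) (G p)" "\<And>x. h (gen p x) = ?f x" by blast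
  have "restrict h (carrier (G p)) \<in> hom (G p) (G p)"
    using h(1) by (auto simp: hom_def)
  with h(2) assms have "realizes (restrict h (carrier (G p))) M s"
    by (simp add: realizes_def End_iff)
  then show ?thesis by (rule that)
qed

lemma center_nf:
  assumes "g \<in> group_center (G p)"
  obtains w where "g = nf (0, w)"
proof -
  obtain e where "g = nf e" using nf_surj[OF group_center_closed[OF assms]] .
  then obtain x z where g: "g = nf (x, z)" by (cases e) simp
  have comm: "int p dvd (bil x y - bil y x) $ i" for y i
  proof -
    have "commutator (G p) g (nf (y, 0)) = \<one>\<^bsub>G p\<^esub>"
      using commutator_eq_one_iff[OF group_center_closed[OF assms] nf_closed]
        group_center_commutes[OF assms nf_closed] by blast
    then have "nf (0, bil x y - bil y x) = nf (0, 0)" unfolding g nf_commutator nf_0 .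
    from nf_snd_eqD[OF p_pos this, of i] show ?thesis by simp
  qed
  \<comment> \<open>Commuting with \<open>a1\<close> kills the \<open>b\<close>-exponents, commuting
    with \<open>b1\<close> the \<open>a\<close>-exponents.\<close>
  have "\<forall>i. int p dvd (x - 0) $ i"
    unfolding forall_4 using comm[of "vec4 1 0 0 0" 1] comm[of "vec4 1 0 0 0" 2]
      comm[of "vec4 0 0 1 0" 1] comm[of "vec4 0 0 1 0" 3] by (simp add: bil_def)
  then obtain w where "nf (x, z) = nf (0, w)" using nf_cong_fst[of x 0 z] by blast
  then show ?thesis using g that by blast
qed

section \<open>Every endomorphism comes from a pair\<close>

lemma realizesI:
  assumes "\<phi> \<in> carrier (End (G p))" "s \<in> carrier (S1 p)" "\<And>x. \<exists>w. \<phi> (gen p x) = nf (base s x, w)"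
  obtains M where "realizes \<phi> M s"
proof -
  obtain w where w: "\<And>x. \<phi> (gen p x) = nf (base s x, w x)" using assms(3) by metis
  define M :: "int ^ 4 ^ 4" where "M = (\<chi> i j. w (gx j) $ i mod int p)"
  have "\<phi> (gen p x) = nf (base s x, column (ix x) M)" for x
    unfolding w by (rule nf_cong_snd) (simp add: M_def column_def gx_ix mod_eq_dvd_iff[symmetric])
  moreover have "M \<in> carrier (Mat p)" using p_pos by (simp add: Mat_iff M_def)
  ultimately have "realizes \<phi> M s" using assms(1,2) unfolding realizes_def by blast
  then show ?thesis by (rule that)
qed

lemma realizes_SomeI:
  assumes "\<phi> \<in> carrier (End (G p))" "\<And>x. \<exists>n w. \<phi> (gen p x) = nf (n *s kv, w)"
  obtains M v where "realizes \<phi> M (Some v)"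
proof -
  obtain n w where w: "\<And>x. \<phi> (gen p x) = nf (n x *s kv, w x)" using assms(2) by metis
  define v :: "int ^ 4" where "v = (\<chi> j. n (gx j) mod int p)"
  have "v \<in> vecs p" using p_pos by (simp add: vecs_iff[OF p_gt_1] v_def)
  moreover have "\<phi> (gen p x) = nf (base (Some v) x, w x)" for x
    unfolding w base_def option.case
    by (rule nf_kv_cong) (simp_all add: v_def gx_ix mod_eq_dvd_iff[symmetric])
  ultimately obtain M where "realizes \<phi> M (Some v)"
    using realizesI[OF assms(1), of "Some v"] by (metis S1_iff option.inject)
  then show ?thesis by (rule that)
qed

lemma choose_2_cases: "int p = 2 \<longrightarrow> int (p choose 2) = 1" "int p \<noteq> 2 \<longrightarrow> int p dvd int (p choose 2)"
proof -
  have "2 < p" if "p \<noteq> 2" using that p_gt_1 by linarith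
  then have "p \<noteq> 2 \<Longrightarrow> p dvd p choose 2"
    using prime p_pos dvd_choose_prime[of 2 p] by simp
  then show "int p \<noteq> 2 \<longrightarrow> int p dvd int (p choose 2)" by force
  show "int p = 2 \<longrightarrow> int (p choose 2) = 1"
  proof
    assume "int p = 2"
    then have "p = 2" by simp
    then show "int (p choose 2) = 1" by simp
  qed
qed

lemma End_realizes:
  assumes "\<phi> \<in> carrier (End (G p))"
  obtains M s where "realizes \<phi> M s"
proof -
  interpret h: group_hom "G p" "G p" \<phi> by (rule End_group_hom[OF assms])
  have "\<exists>e. \<phi> (gen p x) = nf e" for x using nf_surj[OF h.hom_closed[OF gen_closed]] by metis
  then obtain e where e: "\<And>x. \<phi> (gen p x) = nf (e x)" by metis
  define X where "X x = fst (e x)" for x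
  define Z where "Z x = snd (e x)" for x
  have \<phi>: "\<phi> (gen p x) = nf (X x, Z x)" for x unfolding e X_def Z_def by simp
  let ?C = "int (p choose 2)"
  note push = h.hom_nat_pow[OF gen_closed] h.hom_commutator[OF gen_closed gen_closed]
    h.hom_commutator[OF gen_closed m_closed[OF gen_closed gen_closed]]
    h.hom_mult[OF gen_closed gen_closed] h.hom_one
  \<comment> \<open>Applying \<open>\<phi>\<close> to each defining relation gives an equation
    between central normal forms, so their coordinates agree modulo \<open>p\<close>.\<close>
  note rels = gen_relations[THEN arg_cong[where f = \<phi>], unfolded push, unfolded \<phi> nf_pow_p nf_mult nf_commutator,
      folded nf_0]
  note dvds = rels[THEN nf_snd_eqD[OF p_pos]]
  let ?s1 = "X A1 $ 1" and ?s2 = "X A1 $ 2" and ?t1 = "X A1 $ 3" and ?t2 = "X A1 $ 4"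
  let ?S1 = "X A2 $ 1" and ?S2 = "X A2 $ 2" and ?T1 = "X A2 $ 3" and ?T2 = "X A2 $ 4"
  let ?m1 = "X B1 $ 1" and ?m2 = "X B1 $ 2" and ?n1 = "X B1 $ 3" and ?n2 = "X B1 $ 4"
  let ?q1 = "X B2 $ 1" and ?q2 = "X B2 $ 2" and ?r1 = "X B2 $ 3" and ?r2 = "X B2 $ 4"
  let ?P = "int p"
  note simps = powv_def bil_def algebra_simps
  have a: "?P dvd ?s1 + ?s2 - ?C*(?s1*?t1) - (?s1*?n1 - ?m1*?t1)"
    "?P dvd - (?C*(?s1*?t2)) - (?s1*?n2-?m1*?t2)"
    "?P dvd ?t1 - ?C*(?s2*?t1) - (?s2*?n1-?m2*?t1)"
      "?P dvd ?t1+?t2 - ?C*(?s2*?t2) - (?s2*?n2-?m2*?t2)"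
    using dvds(1)[of 1] dvds(1)[of 2] dvds(1)[of 3] dvds(1)[of 4] by (simp_all add: simps)
  have u: "?P dvd ?S1 + ?S2 - ?C*(?S1*?T1) - (?s1*?n1 - ?m1*?t1)"
    "?P dvd - (?C*(?S1*?T2)) - (?s1*?n2-?m1*?t2)"
    "?P dvd ?T1 - ?C*(?S2*?T1) - (?s2*?n1-?m2*?t1)"
      "?P dvd ?T1+?T2 - ?C*(?S2*?T2) - (?s2*?n2-?m2*?t2)"
    using dvds(2)[of 1] dvds(2)[of 2] dvds(2)[of 3] dvds(2)[of 4] by (simp_all add: simps)
  have b: "?P dvd ?m1 + ?m2 - ?C*(?m1*?n1) - (?S1*(?n1+?r1) - (?m1+?q1)*?T1)"
    "?P dvd - (?C*(?m1*?n2)) - (?S1*(?n2+?r2)-(?m1+?q1)*?T2)"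
    "?P dvd ?n1 - ?C*(?m2*?n1) - (?S2*(?n1+?r1)-(?m2+?q2)*?T1)"
      "?P dvd ?n1+?n2 - ?C*(?m2*?n2) - (?S2*(?n2+?r2)-(?m2+?q2)*?T2)"
    using dvds(3)[of 1] dvds(3)[of 2] dvds(3)[of 3] dvds(3)[of 4] by (simp_all add: simps)
  have c: "?P dvd ?q1 + ?q2 - ?C*(?q1*?r1) - (?S1*?r1 - ?q1*?T1)"
    "?P dvd - (?C*(?q1*?r2)) - (?S1*?r2-?q1*?T2)"
    "?P dvd ?r1 - ?C*(?q2*?r1) - (?S2*?r1-?q2*?T1)"
      "?P dvd ?r1+?r2 - ?C*(?q2*?r2) - (?S2*?r2-?q2*?T2)"
    using dvds(4)[of 1] dvds(4)[of 2] dvds(4)[of 3] dvds(4)[of 4] by (simp_all add: simps)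
  have d: "?P dvd ?s1*?T1-?S1*?t1" "?P dvd ?s1*?T2-?S1*?t2" "?P dvd ?s2*?T1-?S2*?t1"
    "?P dvd ?s2*?T2-?S2*?t2"
    using dvds(5)[of 1] dvds(5)[of 2] dvds(5)[of 3] dvds(5)[of 4] by (simp_all add: simps)
  have e: "?P dvd ?m1*?r1-?q1*?n1" "?P dvd ?m1*?r2-?q1*?n2" "?P dvd ?m2*?r1-?q2*?n1"
    "?P dvd ?m2*?r2-?q2*?n2"
    using dvds(6)[of 1] dvds(6)[of 2] dvds(6)[of 3] dvds(6)[of 4] by (simp_all add: simps)
  have "prime ?P" using prime by simp
  from endo_classification[OF this choose_2_cases a u b c d e]
  consider (id) "\<And>x. \<forall>i. ?P dvd (X x - fst (hat_gen x)) $ i"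
    | (deg) "\<And>x. ?P dvd X x $ 1 + X x $ 2 \<and> ?P dvd X x $ 3 \<and> ?P dvd X x $ 4"
  proof (elim disjE)
    assume A: "?P dvd ?s1 - 1 \<and> ?P dvd ?s2 \<and> ?P dvd ?t1 \<and> ?P dvd ?t2 \<and> ?P dvd ?S1 \<and> ?P dvd ?S2 - 1
      \<and> ?P dvd ?T1 \<and> ?P dvd ?T2
    \<and> ?P dvd ?m1 \<and> ?P dvd ?m2 \<and> ?P dvd ?n1 - 1 \<and> ?P dvd ?n2 \<and> ?P dvd ?q1 \<and> ?P dvd ?q2 \<and> ?P dvd ?r1
      \<and> ?P dvd ?r2 - 1"
    have "\<forall>i. ?P dvd (X x - fst (hat_gen x)) $ i" for x
      using A by (cases x) (simp_all add: hat_gen_simps forall_4)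
    then show thesis by (rule that(1))
  next
    assume A: "?P dvd ?s1+?s2 \<and> ?P dvd ?S1+?S2 \<and> ?P dvd ?m1+?m2 \<and> ?P dvd ?q1+?q2 \<and> ?P dvd ?t1
      \<and> ?P dvd ?t2 \<and> ?P dvd ?T1 \<and> ?P dvd ?T2
     \<and> ?P dvd ?n1 \<and> ?P dvd ?n2 \<and> ?P dvd ?r1 \<and> ?P dvd ?r2"
    have "?P dvd X x $ 1 + X x $ 2 \<and> ?P dvd X x $ 3 \<and> ?P dvd X x $ 4" for x
      using A by (cases x) simp_all
    then show thesis by (rule that(2))
  qed
  then show ?thesis
  proof cases
    case id
    have "\<exists>w. \<phi> (gen p x) = nf (base None x, w)" for x
      unfolding \<phi> base_def option.case using nf_cong_fst[of "X x" "fst (hat_gen x)"] id by metis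
    moreover have "None \<in> carrier (S1 p)" by (simp add: S1_iff)
    ultimately show ?thesis using realizesI[OF assms, of None] that by blast
  next
    case deg
    have "\<exists>n w. \<phi> (gen p x) = nf (n *s kv, w)" for x
    proof -
      \<comment> \<open>The degenerate case says that the second exponent is minus the first and the
        others vanish, so the first exponent is the coefficient of \<open>kv\<close>.\<close>
      have "\<forall>i. ?P dvd (X x - X x $ 1 *s kv) $ i"
        unfolding forall_4 using deg[of x] by (simp add: add.commute)
      then show ?thesis unfolding \<phi> using nf_cong_fst[of "X x" "X x $ 1 *s kv"] by metis
    qed
    then show ?thesis using realizes_SomeI[OF assms] that by blast
  qed
qed

section \<open>The endomorphism monoid and its identity\<close>

lemma one_End: "\<one>\<^bsub>End (G p)\<^esub> = (\<lambda>g\<in>carrier (G p). g)"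
  by (simp add: End_def)

lemma monoid_End: "monoid (End (G p))"
proof (rule monoidI)
  fix f g h assume "f \<in> carrier (End (G p))" "g \<in> carrier (End (G p))" "h \<in> carrier (End (G p))"
  then have fgh: "f \<in> hom (G p) (G p)" "g \<in> hom (G p) (G p)" "h \<in> hom (G p) (G p)"
    and ext: "f \<in> extensional (carrier (G p))"
    by (simp_all add: End_iff)
  then have Pi: "g \<in> carrier (G p) \<rightarrow> carrier (G p)" "h \<in> carrier (G p) \<rightarrow> carrier (G p)"
    by (auto simp: hom_def)
  show "f \<otimes>\<^bsub>End (G p)\<^esub> g \<in> carrier (End (G p))"
    using fgh by (auto simp: End_def hom_def compose_def Pi_iff)
  show "f \<otimes>\<^bsub>End (G p)\<^esub> g \<otimes>\<^bsub>End (G p)\<^esub> h = f \<otimes>\<^bsub>End (G p)\<^esub> (g \<otimes>\<^bsub>End (G p)\<^esub> h)"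
    using Pi by (auto simp: End_def compose_def restrict_def fun_eq_iff)
  show "\<one>\<^bsub>End (G p)\<^esub> \<otimes>\<^bsub>End (G p)\<^esub> f = f" "f \<otimes>\<^bsub>End (G p)\<^esub> \<one>\<^bsub>End (G p)\<^esub> = f"
    using ext fgh(1) by (auto simp: End_def compose_def restrict_def fun_eq_iff extensional_def hom_def Pi_iff)
next
  show "\<one>\<^bsub>End (G p)\<^esub> \<in> carrier (End (G p))"
    by (auto simp: End_def hom_def)
qed

lemma zero_Mat: "\<one>\<^bsub>Mat p\<^esub> = 0" "0 \<in> carrier (Mat p)"
  using p_pos by (simp_all add: Mat_def residue_ring_ops[OF p_gt_1] vec_eq_iff)

lemma zero_vecs: "0 \<in> vecs p"
  using p_pos by (simp add: vecs_iff[OF p_gt_1])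

lemma column_0: "column j 0 = (0 :: int ^ 4)"
  by (simp add: column_def vec_eq_iff)

lemma realizes_one: "realizes \<one>\<^bsub>End (G p)\<^esub> 0 None"
  unfolding realizes_def
  using monoid.one_closed[OF monoid_End] zero_Mat
  by (simp add: S1_iff one_End base_def column_0 nf_gen[symmetric] hat_gen_def)

section \<open>Action on the center and on \<open>a1 a2^-1\<close>, and composition\<close>

lemma a1_a2_inv_nf: "a1_a2_inv p = nf (kv, 0)"
  unfolding a1_a2_inv_def nf_gen[symmetric] hat_gen_simps nf_inv nf_mult
  by (rule arg_cong[where f = nf]) (simp add: vec4_eq_iff bil_def)

lemma a1_a2_inv_pow: "a1_a2_inv p \<up> n = nf (n *s kv, 0)"
  unfolding a1_a2_inv_nf by (simp add: nf_int_pow vector_smult_rzero)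

text \<open>The image of a basis commutator depends only on the base vectors: they are the original
  ones for \<open>None\<close>, and commuting multiples of \<open>kv\<close> for
  \<open>Some v\<close>.\<close>

lemma realizes_center:
  assumes "realizes \<phi> M s"
  shows "\<phi> (nf (0, z)) = (case s of None \<Rightarrow> nf (0, z) | Some v \<Rightarrow> \<one>\<^bsub>G p\<^esub>)"
proof -
  interpret h: group_hom "G p" "G p" \<phi> using assms End_group_hom unfolding realizes_def by blast
  have "\<phi> (cc x y) = (case s of None \<Rightarrow> cc x y | Some v \<Rightarrow> \<one>\<^bsub>G p\<^esub>)" for x y
  proof -
    have "\<phi> (cc x y) = nf (0, bil (base s x) (base s y) - bil (base s y) (base s x))"
      using assms unfolding h.hom_commutator[OF gen_closed gen_closed] realizes_def
      by (simp add: nf_commutator)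
    moreover have "cc x y = nf (0, bil (base None x) (base None y) - bil (base None y) (base None x))"
    proof -
      have "gen p x = nf (base None x, 0)" for x
        by (simp add: base_def nf_gen[symmetric] hat_gen_def)
      then show ?thesis by (simp add: nf_commutator)
    qed
    ultimately show ?thesis by (cases s) (simp_all add: base_def nf_0)
  qed
  then show ?thesis unfolding nf_central center_elem_def
    by (cases s) (simp_all add: h.hom_int_pow cc_closed)
qed

text \<open>The origin of the factor \<open>x1 - x2\<close> in \<open>S_op\<close> and of the
  difference of the first two columns in \<open>psi\<close>.\<close>

lemma realizes_a1_a2_inv:
  assumes "realizes \<phi> M s"
  shows "\<phi> (nf (kv, 0)) = nf ((case s of None \<Rightarrow> 1 | Some v \<Rightarrow> v $ 1 - v $ 2) *s kv, column 1 M - column 2 M)"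
proof -
  interpret h: group_hom "G p" "G p" \<phi> using assms End_group_hom unfolding realizes_def by blast
  have "\<phi> (nf (kv, 0)) = \<phi> (gen p A1) \<cdot> inv\<^bsub>G p\<^esub> \<phi> (gen p A2)"
    unfolding a1_a2_inv_nf[symmetric] a1_a2_inv_def by simp
  also have "\<dots> = nf (base s A1, column 1 M) \<cdot> inv\<^bsub>G p\<^esub> nf (base s A2, column 2 M)"
    using assms unfolding realizes_def by (simp add: ix_def)
  also have "\<dots> = nf ((case s of None \<Rightarrow> 1 | Some v \<Rightarrow> v $ 1 - v $ 2) *s kv, column 1 M - column 2 M)"
    unfolding nf_inv nf_mult
    by (rule arg_cong[where f = nf], cases s)
      (simp_all add: base_def hat_gen_def bil_def ix_def vec4_eq_iff algebra_simps)
  finally show ?thesis .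
qed

lemma realizes_kv:
  assumes "realizes \<phi> M s"
  shows "\<phi> (nf (n *s kv, z)) =
    nf ((n * (case s of None \<Rightarrow> 1 | Some v \<Rightarrow> v $ 1 - v $ 2)) *s kv,
      n *s (column 1 M - column 2 M) + (case s of None \<Rightarrow> z | Some v \<Rightarrow> 0))"
proof -
  interpret h: group_hom "G p" "G p" \<phi> using assms End_group_hom unfolding realizes_def by blast
  have "nf (n *s kv, z) = nf (kv, 0) \<up> n \<cdot> nf (0, z)"
    by (simp add: nf_int_pow nf_mult vector_smult_rzero)
  then have "\<phi> (nf (n *s kv, z)) = \<phi> (nf (kv, 0)) \<up> n \<cdot> \<phi> (nf (0, z))"
    by (simp add: h.hom_int_pow)
  then show ?thesis
    unfolding realizes_a1_a2_inv[OF assms] realizes_center[OF assms]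
    by (cases s) (simp_all add: nf_int_pow nf_mult nf_0[symmetric] vector_smult_assoc)
qed

abbreviation target where "target \<equiv> two_sided_semidirect (Mat p) (S1 p) (phi p) (psi p)"

lemma monoid_target: "monoid target"
  by (rule two_sided_action.monoid_two_sided_semidirect[OF two_sided_action_Mat_S1[OF p_gt_1]])

lemma carrier_target: "carrier target = carrier (Mat p) \<times> carrier (S1 p)"
  and mult_target: "(M, s) \<otimes>\<^bsub>target\<^esub> (M', s') =
    (psi p M s' \<otimes>\<^bsub>Mat p\<^esub> phi p s M', s \<otimes>\<^bsub>S1 p\<^esub> s')"
  by (simp_all add: two_sided_semidirect_def)

lemma S1_mult:
  "None \<otimes>\<^bsub>S1 p\<^esub> s = s" "s \<otimes>\<^bsub>S1 p\<^esub> None = s" "Some v \<otimes>\<^bsub>S1 p\<^esub> Some v' = Some (S_op p v v')"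
  by (simp_all add: S1_def adjoin_one_def split: option.split)

lemma dvd_diff_mod_iff: "int p dvd a - b mod int p \<longleftrightarrow> int p dvd a - b"
  by (simp add: mod_eq_dvd_iff[symmetric])

lemma realizes_mult:
  assumes r: "realizes \<phi> M s" and r': "realizes \<phi>' M' s'"
  shows "realizes (\<phi> \<otimes>\<^bsub>End (G p)\<^esub> \<phi>')
    (psi p M s' \<otimes>\<^bsub>Mat p\<^esub> phi p s M') (s \<otimes>\<^bsub>S1 p\<^esub> s')"
  unfolding realizes_def
proof (intro conjI allI)
  have End: "\<phi> \<in> carrier (End (G p))" "\<phi>' \<in> carrier (End (G p))"
    and M: "M \<in> carrier (Mat p)" "M' \<in> carrier (Mat p)"
    and S: "s \<in> carrier (S1 p)" "s' \<in> carrier (S1 p)"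
    using assms unfolding realizes_def by blast+
  show "\<phi> \<otimes>\<^bsub>End (G p)\<^esub> \<phi>' \<in> carrier (End (G p))"
    by (rule monoid.m_closed[OF monoid_End End])
  \<comment> \<open>Membership of both components of the product is inherited from the monoid law of
    \<open>target\<close>.\<close>
  have "(M, s) \<otimes>\<^bsub>target\<^esub> (M', s') \<in> carrier target"
    by (rule monoid.m_closed[OF monoid_target]) (use M S in \<open>simp_all add: carrier_target\<close>)
  then show "psi p M s' \<otimes>\<^bsub>Mat p\<^esub> phi p s M' \<in> carrier (Mat p)" "s \<otimes>\<^bsub>S1 p\<^esub> s' \<in> carrier (S1 p)"
    by (simp_all add: carrier_target mult_target)
  fix x
  interpret h: group_hom "G p" "G p" \<phi> by (rule End_group_hom[OF End(1)])
  have gen: "\<phi> (gen p x) = nf (base s x, column (ix x) M)" using r unfolding realizes_def by blast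
  have "(\<phi> \<otimes>\<^bsub>End (G p)\<^esub> \<phi>') (gen p x) = \<phi> (\<phi>' (gen p x))"
    by (simp add: End_def compose_def)
  also have "\<dots> = \<phi> (nf (base s' x, column (ix x) M'))" using r' unfolding realizes_def by simp
  also have "\<dots> = nf (base (s \<otimes>\<^bsub>S1 p\<^esub> s') x, column (ix x) (psi p M s' \<otimes>\<^bsub>Mat p\<^esub> phi p s M'))"
  proof (cases s')
    case None
    \<comment> \<open>Here \<open>\<phi>'\<close> multiplies each generator by a central element,
      which \<open>\<phi>\<close> fixes or kills; this is the left action
      \<open>phi\<close>.\<close>
    have "nf (base s' x, column (ix x) M') = gen p x \<cdot> nf (0, column (ix x) M')"
      unfolding None nf_gen[symmetric] by (simp add: base_def hat_gen_def nf_mult)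
    then have "\<phi> (nf (base s' x, column (ix x) M')) =
        nf (base s x, column (ix x) M + (case s of None \<Rightarrow> column (ix x) M' | Some v \<Rightarrow> 0))"
      unfolding gen[symmetric]
      by (cases s) (simp_all add: realizes_center[OF r] gen nf_mult nf_0[symmetric])
    also have "\<dots> = nf (base s x, column (ix x) (M \<otimes>\<^bsub>Mat p\<^esub> phi p s M'))"
      by (rule nf_cong_snd, cases s) (simp_all add: Mat_def phi_def column_def
          residue_ring_ops[OF p_gt_1] mod_eq_dvd_iff[symmetric])
    finally show ?thesis unfolding None S1_mult by (simp add: psi_def)
  next
    case (Some v')
    let ?k = "case s of None \<Rightarrow> 1 | Some v \<Rightarrow> v $ 1 - v $ 2"
    let ?z = "v' $ ix x *s (column 1 M - column 2 M) + (case s of None \<Rightarrow> column (ix x) M' | Some v \<Rightarrow> 0)"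
    \<comment> \<open>Here the inner image is a power of \<open>a1 a2^-1\<close> times a central
      element. The power produces \<open>S_op\<close> and \<open>psi\<close>, the central factor
      again produces \<open>phi\<close>; what remains is reduction modulo \<open>p\<close>.\<close>
    have "\<phi> (nf (base s' x, column (ix x) M')) = nf ((v' $ ix x * ?k) *s kv, ?z)"
      unfolding Some base_def option.case by (rule realizes_kv[OF r])
    also have "\<dots> = nf (base (s \<otimes>\<^bsub>S1 p\<^esub> s') x, column (ix x) (psi p M s' \<otimes>\<^bsub>Mat p\<^esub> phi p s M'))"
    proof -
      have snd_cong: "int p dvd (?z - column (ix x) (psi p M s' \<otimes>\<^bsub>Mat p\<^esub> phi p s M')) $ i" for i
      proof -
        have reduce: "(a * (b mod int p) + c) mod int p = (a * b + c) mod int p" for a b c :: int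
          by (metis mod_add_left_eq mod_mult_right_eq)
        have carr: "M $ i $ j \<in> carrier (Fp p)" for j using M(1) by (simp add: Mat_def)
        have entry: "(psi p M s' \<otimes>\<^bsub>Mat p\<^esub> phi p s M') $ i $ j =
            (v' $ j * (M $ i $ 1 - M $ i $ 2) + phi p s M' $ i $ j) mod int p" for j
          using reduce
          by (simp add: Some Mat_def psi_def residue_ring_ops(3-5)[OF p_gt_1] carr mod_add_left_eq)
        have col: "column j A $ i = A $ i $ j" for j and A :: "int ^ 4 ^ 4"
          by (simp add: column_def)
        show ?thesis
          unfolding vector_minus_component col entry dvd_diff_mod_iff
          by (cases s) (simp_all add: col phi_def residue_ring_ops(2)[OF p_gt_1])
      qed
      have "\<exists>m. base (s \<otimes>\<^bsub>S1 p\<^esub> s') x = m *s kv \<and> int p dvd v' $ ix x * ?k - m"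
      proof (cases s)
        case None
        then show ?thesis unfolding Some None S1_mult base_def
          by (intro exI[of _ "v' $ ix x"]) simp
      next
        case (Some v)
        then have "v $ j \<in> carrier (Fp p)" for j using S(1) by (simp add: S1_iff vecs_def)
        then have "S_op p v v' $ j = ((v $ 1 - v $ 2) * v' $ j) mod int p" for j
          by (simp add: S_op_def residue_ring_ops(4,5)[OF p_gt_1] mod_mult_left_eq)
        then show ?thesis unfolding \<open>s' = Some v'\<close> Some S1_mult base_def option.case
          by (intro exI[of _ "S_op p v v' $ ix x"]) (simp add: dvd_diff_mod_iff mult.commute)
      qed
      then obtain m where m: "base (s \<otimes>\<^bsub>S1 p\<^esub> s') x = m *s kv" "int p dvd v' $ ix x * ?k - m"
        by blast
      show ?thesis unfolding m(1) by (rule nf_kv_cong[OF m(2) snd_cong])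
    qed
    finally show ?thesis .
  qed
  finally show "(\<phi> \<otimes>\<^bsub>End (G p)\<^esub> \<phi>') (gen p x) =
    nf (base (s \<otimes>\<^bsub>S1 p\<^esub> s') x, column (ix x) (psi p M s' \<otimes>\<^bsub>Mat p\<^esub> phi p s M'))" .
qed

section \<open>Normalized and central endomorphisms\<close>

lemma generate_a1_a2_inv: "generate (G p) {a1_a2_inv p} = {nf (n *s kv, 0) | n. True}"
proof -
  have "a1_a2_inv p \<in> carrier (G p)" unfolding a1_a2_inv_nf by (rule nf_closed)
  from generate_pow[OF this] show ?thesis unfolding a1_a2_inv_pow by simp
qed

lemma normalized_iff: "normalized p \<nu> \<longleftrightarrow> (\<exists>s. realizes \<nu> 0 s)"
proof
  assume n: "normalized p \<nu>"
  show "\<exists>s. realizes \<nu> 0 s"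
  proof (cases "\<nu> = \<one>\<^bsub>End (G p)\<^esub>")
    case True
    then show ?thesis using realizes_one by blast
  next
    case False
    have End: "\<nu> \<in> carrier (End (G p))" using n unfolding normalized_def by blast
    have "\<nu> (gen p x) \<in> {nf (n *s kv, 0) | n. True}" for x
      using n False unfolding normalized_def generate_a1_a2_inv by blast
    then have "\<exists>n. \<nu> (gen p x) = nf (n *s kv, 0)" for x by blast
    then obtain n where n: "\<And>x. \<nu> (gen p x) = nf (n x *s kv, 0)" by metis
    define v :: "int ^ 4" where "v = (\<chi> j. n (gx j) mod int p)"
    have "v \<in> vecs p" using p_pos by (simp add: vecs_iff[OF p_gt_1] v_def)
    moreover have "\<nu> (gen p x) = nf (base (Some v) x, column (ix x) 0)" for x
      unfolding n base_def option.case
      by (rule nf_kv_cong) (simp_all add: v_def gx_ix dvd_diff_mod_iff column_0)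
    ultimately have "realizes \<nu> 0 (Some v)" using End zero_Mat S1_iff by (simp add: realizes_def)
    then show ?thesis by blast
  qed
next
  assume "\<exists>s. realizes \<nu> 0 s"
  then obtain s where s: "realizes \<nu> 0 s" by blast
  have End: "\<nu> \<in> carrier (End (G p))" using s unfolding realizes_def by blast
  show "normalized p \<nu>"
  proof (cases s)
    case None
    then have "\<nu> = \<one>\<^bsub>End (G p)\<^esub>" using s realizes_one realizes_eq by blast
    then show ?thesis using End unfolding normalized_def by blast
  next
    case (Some v)
    have "\<nu> (gen p x) = nf ((v $ ix x) *s kv, 0)" for x
      using s unfolding realizes_def Some base_def option.case column_0 by blast
    then show ?thesis using End unfolding normalized_def generate_a1_a2_inv by blast
  qed
qed

lemma base_Some_0: "base (Some 0) x = 0"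
  by (simp add: base_def vec_eq_iff)

lemma S1_Some_0: "Some 0 \<in> carrier (S1 p)"
  using zero_vecs by (simp add: S1_iff)

text \<open>Central endomorphisms are encoded by the zero vector, so existence and uniqueness for
  \<open>realizes\<close> apply to them as well. Conversely the generators suffice, because the
  center is a subgroup.\<close>

lemma central_end_iff: "central_end p f \<longleftrightarrow> (\<exists>M. realizes f M (Some 0))"
proof
  assume f: "central_end p f"
  then have End: "f \<in> carrier (End (G p))" unfolding central_end_def by blast
  have "\<exists>w. f (gen p x) = nf (base (Some 0) x, w)" for x
  proof -
    have "f (gen p x) \<in> group_center (G p)" using f gen_closed unfolding central_end_def by blast
    then show ?thesis unfolding base_Some_0 by (rule center_nf) blast
  qed
  then show "\<exists>M. realizes f M (Some 0)" using realizesI[OF End S1_Some_0] by metis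
next
  assume "\<exists>M. realizes f M (Some 0)"
  then obtain M where M: "realizes f M (Some 0)" by blast
  then have End: "f \<in> carrier (End (G p))" unfolding realizes_def by blast
  have gen: "f (gen p x) \<in> group_center (G p)" for x
    using M unfolding realizes_def base_Some_0 nf_central by (simp add: center_elem_center)
  have "f g \<in> group_center (G p)" if g: "g \<in> carrier (G p)" for g
  proof -
    obtain w where w: "g = pres_class (G_relations p) w"
      using g unfolding G_def by (rule presented_groupE)
    have "f \<in> hom (presented_group (G_relations p)) (G p)"
      using End unfolding End_iff by (simp add: G_def)
    from hom_presented_group[OF group_G this, of w]
    have "f g = word_eval (G p) (\<lambda>x. f (gen p x)) w" unfolding w gen_def .
    then show ?thesis
      by (simp only:) (rule word_eval_mem_subgroup[OF subgroup_group_center gen])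
  qed
  then show "central_end p f" using End unfolding central_end_def by blast
qed

lemma end_plus_realizes:
  assumes \<nu>: "realizes \<nu> 0 s" and f: "realizes f M (Some 0)"
  shows "realizes (end_plus p \<nu> f) M s"
proof -
  interpret n: group_hom "G p" "G p" \<nu> using \<nu> End_group_hom unfolding realizes_def by blast
  interpret f: group_hom "G p" "G p" f using f End_group_hom unfolding realizes_def by blast
  have cent: "f g \<in> group_center (G p)" if "g \<in> carrier (G p)" for g
    using f that central_end_iff unfolding central_end_def by blast
  have "end_plus p \<nu> f \<in> hom (G p) (G p)"
  proof (rule homI)
    fix g h assume g: "g \<in> carrier (G p)" and h: "h \<in> carrier (G p)"
    have "(\<nu> g \<cdot> f g) \<cdot> (\<nu> h \<cdot> f h) = (\<nu> g \<cdot> \<nu> h) \<cdot> (f g \<cdot> f h)"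
      by (rule m_exchange[OF group_center_commutes[OF cent[OF g] n.hom_closed[OF h]]])
        (simp_all add: g h)
    then show "end_plus p \<nu> f (g \<cdot> h) = end_plus p \<nu> f g \<cdot> end_plus p \<nu> f h"
      using g h by (simp add: end_plus_def)
  qed (simp add: end_plus_def)
  moreover have "end_plus p \<nu> f (gen p x) = nf (base s x, column (ix x) M)" for x
    using \<nu> f unfolding realizes_def base_Some_0
    by (simp add: end_plus_def nf_mult column_0)
  moreover have "end_plus p \<nu> f \<in> extensional (carrier (G p))" by (simp add: end_plus_def)
  ultimately show ?thesis using \<nu> f unfolding realizes_def End_iff by blast
qed

text \<open>Any other decomposition yields another pair realizing \<open>\<phi>\<close>, and such a
  pair is unique; this resolves both definite descriptions.\<close>

lemma decomposition:
  assumes \<phi>: "realizes \<phi> M s" and \<nu>: "realizes \<nu> 0 s" and f: "realizes f M (Some 0)"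
  shows "norm_part p \<phi> = \<nu>" "cent_part p \<phi> = f"
proof -
  have sum: "\<phi> = end_plus p \<nu> f" by (rule realizes_eq[OF \<phi> end_plus_realizes[OF \<nu> f]])
  have n: "normalized p \<nu>" and c: "central_end p f"
    using \<nu> f normalized_iff central_end_iff by blast+
  have unique: "\<nu>' = \<nu> \<and> f' = f"
    if *: "normalized p \<nu>'" "central_end p f'" "\<phi> = end_plus p \<nu>' f'" for \<nu>' f'
  proof -
    obtain s' M' where r: "realizes \<nu>' 0 s'" "realizes f' M' (Some 0)"
      using * normalized_iff central_end_iff by blast
    from end_plus_realizes[OF this] have "realizes \<phi> M' s'" unfolding *(3) .
    from realizes_unique[OF \<phi> this] have "M' = M" "s' = s" by simp_all
    then show ?thesis using r \<nu> f realizes_eq by blast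
  qed
  show "norm_part p \<phi> = \<nu>"
    unfolding norm_part_def by (rule the_equality) (use sum n c unique in blast)+
  show "cent_part p \<phi> = f"
    unfolding cent_part_def by (rule the_equality) (use sum n c unique in blast)+
qed

section \<open>Evaluation of \<open>alpha\<close> and the isomorphism\<close>

lemma all_generator: "(\<forall>x. P x) \<longleftrightarrow> P A1 \<and> P A2 \<and> P B1 \<and> P B2"
  by (metis generator.exhaust)

text \<open>For a non-identity \<open>\<nu>\<close> the predicate under \<open>THE\<close> in
  \<open>vec_of\<close> is exactly \<open>realizes \<nu> 0 (Some x)\<close>.\<close>

lemma vec_of_realizes:
  assumes "realizes \<nu> 0 s"
  shows "vec_of p \<nu> = s"
proof (cases s)
  case None
  then have "\<nu> = \<one>\<^bsub>End (G p)\<^esub>" using assms realizes_one realizes_eq by blast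
  then show ?thesis using None by (simp add: vec_of_def)
next
  case (Some v)
  have "\<nu> \<noteq> \<one>\<^bsub>End (G p)\<^esub>" using assms realizes_one realizes_unique(2) Some by blast
  moreover have "realizes \<nu> 0 (Some x) \<longleftrightarrow> x \<in> vecs p \<and>
      \<nu> (gen p A1) = a1_a2_inv p \<up> (x $ 1) \<and> \<nu> (gen p A2) = a1_a2_inv p \<up> (x $ 2) \<and>
      \<nu> (gen p B1) = a1_a2_inv p \<up> (x $ 3) \<and> \<nu> (gen p B2) = a1_a2_inv p \<up> (x $ 4)" for x
    using assms unfolding realizes_def all_generator a1_a2_inv_pow
    by (simp add: base_def ix_def column_0 S1_iff)
  moreover have "(THE x. realizes \<nu> 0 (Some x)) = v"
    by (rule the_equality) (use assms Some realizes_unique(2) in blast)+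
  ultimately show ?thesis by (simp add: vec_of_def Some)
qed

lemma mat_of_realizes:
  assumes "realizes f M (Some 0)"
  shows "mat_of p f = M"
proof -
  have "realizes f A (Some 0) \<longleftrightarrow> A \<in> carrier (Mat p) \<and>
    f (gen p A1) = center_elem p (column 1 A) \<and> f (gen p A2) = center_elem p (column 2 A) \<and>
    f (gen p B1) = center_elem p (column 3 A) \<and> f (gen p B2) = center_elem p (column 4 A)" for A
    using assms unfolding realizes_def all_generator base_Some_0 nf_central
    by (simp add: ix_def)
  moreover have "(THE A. realizes f A (Some 0)) = M"
    by (rule the_equality) (use assms realizes_unique(1) in blast)+
  ultimately show ?thesis by (simp add: mat_of_def)
qed

lemma alpha_realizes:
  assumes "realizes \<phi> M s"
  shows "alpha p \<phi> = (M, s)"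
proof -
  have Ms: "M \<in> carrier (Mat p)" "s \<in> carrier (S1 p)" using assms unfolding realizes_def by blast+
  obtain \<nu> where \<nu>: "realizes \<nu> 0 s" by (rule realizes_exists[OF zero_Mat(2) Ms(2)])
  obtain f where f: "realizes f M (Some 0)" by (rule realizes_exists[OF Ms(1) S1_Some_0])
  show ?thesis
    unfolding alpha_def decomposition[OF assms \<nu> f] vec_of_realizes[OF \<nu>] mat_of_realizes[OF f] ..
qed

lemma alpha_iso: "alpha p \<in> iso (End (G p)) target"
proof (rule isoI)
  show "alpha p \<in> hom (End (G p)) target"
  proof (rule homI)
    fix \<phi> assume "\<phi> \<in> carrier (End (G p))"
    then obtain M s where r: "realizes \<phi> M s" by (rule End_realizes)
    then show "alpha p \<phi> \<in> carrier target"
      unfolding alpha_realizes[OF r] carrier_target by (simp add: realizes_def)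
  next
    fix \<phi> \<phi>' assume "\<phi> \<in> carrier (End (G p))" "\<phi>' \<in> carrier (End (G p))"
    then obtain M s M' s' where r: "realizes \<phi> M s" "realizes \<phi>' M' s'"
      using End_realizes by metis
    show "alpha p (\<phi> \<otimes>\<^bsub>End (G p)\<^esub> \<phi>') = alpha p \<phi> \<otimes>\<^bsub>target\<^esub> alpha p \<phi>'"
      unfolding alpha_realizes[OF realizes_mult[OF r]] alpha_realizes[OF r(1)] alpha_realizes[OF r(2)]
        mult_target ..
  qed
  show "bij_betw (alpha p) (carrier (End (G p))) (carrier target)"
  proof (rule bij_betwI')
    fix \<phi> \<phi>' assume "\<phi> \<in> carrier (End (G p))" "\<phi>' \<in> carrier (End (G p))"
    then obtain M s M' s' where r: "realizes \<phi> M s" "realizes \<phi>' M' s'"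
      using End_realizes by metis
    show "alpha p \<phi> = alpha p \<phi>' \<longleftrightarrow> \<phi> = \<phi>'"
      using r realizes_eq unfolding alpha_realizes[OF r(1)] alpha_realizes[OF r(2)]
      by (metis alpha_realizes prod.inject)
  next
    fix \<phi> assume "\<phi> \<in> carrier (End (G p))"
    then obtain M s where r: "realizes \<phi> M s" by (rule End_realizes)
    then show "alpha p \<phi> \<in> carrier target"
      unfolding alpha_realizes[OF r] carrier_target by (simp add: realizes_def)
  next
    fix y assume "y \<in> carrier target"
    then obtain M s where y: "y = (M, s)" "M \<in> carrier (Mat p)" "s \<in> carrier (S1 p)"
      unfolding carrier_target by blast
    obtain \<phi> where r: "realizes \<phi> M s" by (rule realizes_exists[OF y(2,3)])
    then have "\<phi> \<in> carrier (End (G p))" unfolding realizes_def by blast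
    then show "\<exists>\<phi>\<in>carrier (End (G p)). y = alpha p \<phi>"
      using alpha_realizes[OF r] y(1) by metis
  qed
qed

text \<open>\<open>iso\<close> speaks of products and bijectivity; preservation of the identity is
  stated on its own to obtain an isomorphism of monoids.\<close>

lemma alpha_one: "alpha p \<one>\<^bsub>End (G p)\<^esub> = \<one>\<^bsub>target\<^esub>"
  unfolding alpha_realizes[OF realizes_one]
  by (simp add: two_sided_semidirect_def zero_Mat S1_def adjoin_one_def)

end

theorem corollary1:
  fixes p :: nat
  assumes "prime p"
  shows "monoid (End (G p)) \<and>
    monoid (two_sided_semidirect (Mat p) (S1 p) (phi p) (psi p)) \<and>
    alpha p \<in> iso (End (G p)) (two_sided_semidirect (Mat p) (S1 p) (phi p) (psi p)) \<and>
    alpha p \<one>\<^bsub>End (G p)\<^esub> = \<one>\<^bsub>two_sided_semidirect (Mat p) (S1 p) (phi p) (psi p)\<^esub>"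
proof -
  interpret G_prime p by unfold_locales (rule assms)
  show ?thesis using monoid_End monoid_target alpha_iso alpha_one by blast
qed

end
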